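(* Consider the Gaussian relay channel problem with $N$ agents and cost parameters $l_1,\dots,l_{N-1}>0$, and its finite observation models with costs $J_{l,n}$. For any $\varepsilon>0$ there exist a pair $(l,n)$ (with $l>0$ real and $n\ge1$ an integer) and $m>0$ such that, with $M:=[-m,m]$, any optimal policy $\underline\pi^*=(\pi^{1*},\dots,\pi^{N*})$ in the set $\prod_{i=1}^N\Pi_{l,n}^{i,M}$ for the cost $J_{l,n}$ is $\varepsilon$-optimal for the Gaussian relay channel when extended to $\mathbb R^N$ via $\gamma^i=\pi^{i*}\circ q_{l,n}$, $i=1,\dots,N$; i.e. $J(\pi^{1*}\circ q_{l,n},\dots,\pi^{N*}\circ q_{l,n})\le J^*+\varepsilon$. Here $\Pi_{l,n}^{i,M}$ is the set of maps $\pi^i:\mathsf Z_{l,n}\to\mathbb R$ with $\pi^i(\mathsf Z_{l,n})\subset M$.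
   Context: Gaussian relay channel: $x,v^0,v^1,\dots,v^{N-1}$ are independent standard Gaussian random variables (zero mean, unit variance). Agent 1 observes $y^1=x+v^0$ and plays $u^1=\gamma^1(y^1)$; for $i=2,\dots,N$, Agent $i$ observes $y^i=u^{i-1}+v^{i-1}$ and plays $u^i=\gamma^i(y^i)$, with $\gamma^i:\mathbb R\to\mathbb R$ Borel measurable. The cost function is $c(x,\mathbf u)=(u^N-x)^2+\sum_{i=1}^{N-1}l_i(u^i)^2$, $J(\underline\gamma)=E[c(x,\mathbf u)]$ and $J^*=\inf_{\underline\gamma}J(\underline\gamma)$. Let $f(u,y)=\exp\{-(u^2-2yu)/2\}$ and $\tilde c(x,\mathbf y,\mathbf u)=c(x,\mathbf u)f(x,y^1)\prod_{i=2}^Nf(u^{i-1},y^i)$, so that $J(\underline\gamma)=\int\tilde c(x,\mathbf y,\underline\gamma(\mathbf y))\,\mathbb P_{\mathsf g}(dx)\prod_{i=1}^N\mathbb P_{\mathsf g}(dy^i)$ with $\mathbb P_{\mathsf g}$ the standard Gaussian law and $\underline\gamma(\mathbf y)=(\gamma^1(y^1),\dots,\gamma^N(y^N))$. Finite models: for real $l>0$ and integer $n\ge1$, $q_{l,n}$ is the uniform quantizer on $[-l,l]$ with $n$ output levels: with $\tau=2l/n$, the levels $y_1<\dots<y_n$ are the midpoints of the $n$ consecutive intervals of length $\tau$ partitioning $[-l,l]$, and $q_{l,n}(y)=y_j$ for $y\in[y_j-\tau/2,y_j+\tau/2)$ (the endpoint $l$ is mapped to $y_n$). It is extended to $\mathbb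 R$ by $q_{l,n}(y)=y_0:=0$ for $y\notin[-l,l]$. $\mathsf Z_{l,n}=\{y_0,y_1,\dots,y_n\}$, $\mathbb P_{l,n}=\mathbb P_{\mathsf g}\circ q_{l,n}^{-1}$ on $\mathsf Z_{l,n}$, and for $\underline\pi=(\pi^1,\dots,\pi^N)$ with $\pi^i:\mathsf Z_{l,n}\to\mathbb R$, $J_{l,n}(\underline\pi)=\int_{\mathbb R}\sum_{\mathbf z\in(\mathsf Z_{l,n})^N}\tilde c(x,\mathbf z,\underline\pi(\mathbf z))\prod_{i=1}^N\mathbb P_{l,n}(z^i)\,\mathbb P_{\mathsf g}(dx)$. *)

theory Defs
  imports "HOL-Probability.Probability"
begin

text \<open>
  Agents are numbered \<open>1, \<dots>, N\<close>. A vector such as \<open>u = (u\<^sup>1, \<dots>, u\<^sup>N)\<close> is a function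
  \<open>nat \<Rightarrow> real\<close> of which only the values on \<open>{1..N}\<close> matter, and a team policy is a function
  \<open>nat \<Rightarrow> real \<Rightarrow> real\<close>, again indexed by \<open>{1..N}\<close>. The weights \<open>w i\<close> are used for
  \<open>1 \<le> i \<le> N - 1\<close> and the noises \<open>v i\<close> for \<open>0 \<le> i \<le> N - 1\<close>.
\<close>

definition relay_cost :: "nat \<Rightarrow> (nat \<Rightarrow> real) \<Rightarrow> real \<Rightarrow> (nat \<Rightarrow> real) \<Rightarrow> real" where
  "relay_cost N w x u = (u N - x)\<^sup>2 + (\<Sum>i\<in>{1..<N}. w i * (u i)\<^sup>2)"

text \<open>
  With the convention \<open>u\<^sup>0 = x\<close>, every agent observes \<open>y\<^sup>i = u\<^sup>i\<^sup>-\<^sup>1 + v\<^sup>i\<^sup>-\<^sup>1\<close>; for \<open>i = 1\<close>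
  this is \<open>y\<^sup>1 = x + v\<^sup>0\<close>.
\<close>

primrec relay_action ::
  "(nat \<Rightarrow> real \<Rightarrow> real) \<Rightarrow> real \<Rightarrow> (nat \<Rightarrow> real) \<Rightarrow> nat \<Rightarrow> real" where
  "relay_action \<gamma> x v 0 = x"
| "relay_action \<gamma> x v (Suc i) = \<gamma> (Suc i) (relay_action \<gamma> x v i + v i)"

text \<open>
  Expected costs are taken in \<open>[0, \<infinity>]\<close>, since a measurable policy may have infinite cost.
\<close>

definition relay_J ::
  "'a measure \<Rightarrow> ('a \<Rightarrow> real) \<Rightarrow> (nat \<Rightarrow> 'a \<Rightarrow> real) \<Rightarrow> nat \<Rightarrow> (nat \<Rightarrow> real) \<Rightarrow>
    (nat \<Rightarrow> real \<Rightarrow> real) \<Rightarrow> ennreal" where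
  "relay_J P x v N w \<gamma> =
    (\<integral>\<^sup>+\<omega>. ennreal (relay_cost N w (x \<omega>) (relay_action \<gamma> (x \<omega>) (\<lambda>i. v i \<omega>))) \<partial>P)"

definition relay_J_opt ::
  "'a measure \<Rightarrow> ('a \<Rightarrow> real) \<Rightarrow> (nat \<Rightarrow> 'a \<Rightarrow> real) \<Rightarrow> nat \<Rightarrow> (nat \<Rightarrow> real) \<Rightarrow> ennreal" where
  "relay_J_opt P x v N w =
    (INF \<gamma>\<in>{\<gamma>. \<forall>i\<in>{1..N}. \<gamma> i \<in> borel_measurable borel}. relay_J P x v N w \<gamma>)"

text \<open>
  \<open>relay_f u y\<close> is the density of the law of \<open>u + v\<close>, \<open>v\<close> standard Gaussian, with respect to
  the standard Gaussian law.
\<close>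

definition relay_f :: "real \<Rightarrow> real \<Rightarrow> real" where
  "relay_f u y = exp (- (u\<^sup>2 - 2 * y * u) / 2)"

definition relay_ctilde ::
  "nat \<Rightarrow> (nat \<Rightarrow> real) \<Rightarrow> real \<Rightarrow> (nat \<Rightarrow> real) \<Rightarrow> (nat \<Rightarrow> real) \<Rightarrow> real" where
  "relay_ctilde N w x y u =
    relay_cost N w x u * relay_f x (y 1) * (\<Prod>i\<in>{2..N}. relay_f (u (i - 1)) (y i))"

definition std_gaussian :: "real measure" where
  "std_gaussian = density lborel (\<lambda>t. ennreal (std_normal_density t))"

definition quant_level :: "real \<Rightarrow> nat \<Rightarrow> nat \<Rightarrow> real" where
  "quant_level l n j = - l + (real j - 1 / 2) * (2 * l / real n)"

definition quantizer :: "real \<Rightarrow> nat \<Rightarrow> real \<Rightarrow> real" where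
  "quantizer l n y =
    (let \<tau> = 2 * l / real n in
     if y \<notin> {-l..l} then 0
     else if y = l then quant_level l n n
     else quant_level l n
       (THE j. j \<in> {1..n} \<and> y \<in> {quant_level l n j - \<tau> / 2 ..< quant_level l n j + \<tau> / 2}))"

text \<open>
  For odd \<open>n\<close> the middle level coincides with the overflow value \<open>0\<close>; the two are then the same
  element of the grid, whose mass under \<open>quant_law\<close> is that of the whole preimage of \<open>0\<close>.
\<close>

definition quant_grid :: "real \<Rightarrow> nat \<Rightarrow> real set" where
  "quant_grid l n = insert 0 (quant_level l n ` {1..n})"

definition quant_law :: "real \<Rightarrow> nat \<Rightarrow> real measure" where
  "quant_law l n = distr std_gaussian (count_space (quant_grid l n)) (quantizer l n)"

definition relay_J_fin ::
  "real \<Rightarrow> nat \<Rightarrow> nat \<Rightarrow> (nat \<Rightarrow> real) \<Rightarrow> (nat \<Rightarrow> real \<Rightarrow> real) \<Rightarrow> ennreal" where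
  "relay_J_fin l n N w \<pi> =
    (\<integral>\<^sup>+x. ennreal (\<Sum>z\<in>{1..N} \<rightarrow>\<^sub>E quant_grid l n.
        relay_ctilde N w x z (\<lambda>i. \<pi> i (z i)) * (\<Prod>i\<in>{1..N}. measure (quant_law l n) {z i}))
      \<partial>std_gaussian)"

definition fin_policies :: "real \<Rightarrow> nat \<Rightarrow> nat \<Rightarrow> real set \<Rightarrow> (nat \<Rightarrow> real \<Rightarrow> real) set" where
  "fin_policies l n N M = {1..N} \<rightarrow>\<^sub>E (quant_grid l n \<rightarrow>\<^sub>E M)"

text \<open>The cells in \<^const>\<open>quantizer\<close> partition \<open>[-l, l)\<close>, so the description of \<open>j\<close> is proper.\<close>

lemma quantizer_cell:
  assumes "l > 0" "j \<in> {1..n}"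
    and "quant_level l n j - l / real n \<le> y" "y < quant_level l n j + l / real n"
  shows "quantizer l n y = quant_level l n j"
proof -
  have n: "real n > 0" using assms(2) by auto
  define d where "d = l / real n"
  have d: "d > 0" and ld: "l = real n * d" and tau: "2 * l / real n = 2 * d"
    using assms(1) n by (auto simp: d_def)
  have cell: "(quant_level l n k - d \<le> y \<and> y < quant_level l n k + d) \<longleftrightarrow>
      (real k - 1) * (2 * d) \<le> y + l \<and> y + l < real k * (2 * d)" for k
    unfolding quant_level_def tau by (auto simp: algebra_simps)
  have j: "(real j - 1) * (2 * d) \<le> y + l" "y + l < real j * (2 * d)"
    using cell[of j] assms(3,4) by (auto simp: d_def)
  have uniq: "k = j" if "(real k - 1) * (2 * d) \<le> y + l" "y + l < real k * (2 * d)" for k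
  proof -
    have "(real k - 1) * (2 * d) < real j * (2 * d)" "(real j - 1) * (2 * d) < real k * (2 * d)"
      using that j by linarith+
    then have "real k - 1 < real j" "real j - 1 < real k" using d by auto
    then show ?thesis by linarith
  qed
  have "0 \<le> (real j - 1) * (2 * d)" "real j * (2 * d) \<le> real n * (2 * d)"
    using assms(2) d by auto
  then have "- l \<le> y" "y < l" using j ld by linarith+
  moreover have "(THE k. k \<in> {1..n} \<and> y \<in> {quant_level l n k - (2 * l / real n) / 2
      ..< quant_level l n k + (2 * l / real n) / 2}) = j"
  proof (rule the_equality)
    show "j \<in> {1..n} \<and> y \<in> {quant_level l n j - (2 * l / real n) / 2
      ..< quant_level l n j + (2 * l / real n) / 2}"
      using assms by auto
  next
    fix k
    assume "k \<in> {1..n} \<and> y \<in> {quant_level l n k - (2 * l / real n) / 2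
      ..< quant_level l n k + (2 * l / real n) / 2}"
    then show "k = j" using cell[of k] uniq[of k] by (simp add: tau)
  qed
  ultimately show ?thesis unfolding quantizer_def Let_def by simp
qed

end

theory Submission
  imports Defs
begin

text \<open>
  Change of measure makes the observations \<open>(x, y\<^sup>1, \<dots>, y\<^sup>N)\<close> i.i.d. standard Gaussian, so that \<open>J\<close> and
  the finite costs \<open>J\<^sub>l\<^sub>,\<^sub>n\<close> become integrals against the same law: \<open>J\<^sub>l\<^sub>,\<^sub>n(\<pi>)\<close> differs from
  \<open>J(\<pi> \<circ> q\<^sub>l\<^sub>,\<^sub>n)\<close> only in that the density is evaluated at the quantized observations. For actions
  bounded by \<open>m\<close> the integrands are dominated by a multiple of \<open>exp (3/8 * (x\<^sup>2 + \<Sum>(y\<^sup>i)\<^sup>2))\<close>, which is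
  Gaussian integrable, so the difference vanishes along \<open>l = k + 1, n = (k + 1)\<^sup>2\<close> for every choice of
  bounded policies \<open>\<pi>\<^sub>k\<close>, in particular for the minimizers of the finite problems. It remains to find a
  near optimal policy that is bounded and continuous. Clipping a near optimal policy to \<open>[-m, m]\<close>
  changes its trajectories only where \<open>S = \<Sum>(u\<^sup>i)\<^sup>2 > m\<^sup>2\<close>, and there the new cost is at most
  \<open>2 x\<^sup>2 + C S\<close>, which is integrable because the weights are positive. A bounded policy is
  an almost everywhere limit of continuous ones with the same bound.
\<close>

section \<open>Change of measure\<close>

lemma sets_std_gaussian [simp, measurable_cong]: "sets std_gaussian = sets borel"
  by (simp add: std_gaussian_def)

lemma space_std_gaussian [simp]: "space std_gaussian = UNIV"
  by (simp add: std_gaussian_def)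

lemma prob_space_std_gaussian: "prob_space std_gaussian"
  unfolding std_gaussian_def by (rule prob_space_normal_density) simp

interpretation std_gaussian: prob_space std_gaussian
  by (rule prob_space_std_gaussian)

interpretation gaussian_product: product_sigma_finite "\<lambda>_ :: nat. std_gaussian"
  by (rule product_sigma_finite.intro) (rule std_gaussian.sigma_finite_measure_axioms)

lemma borel_measurable_relay_f [measurable]:
  "f \<in> borel_measurable M \<Longrightarrow> g \<in> borel_measurable M \<Longrightarrow>
    (\<lambda>x. relay_f (f x) (g x)) \<in> borel_measurable M"
  unfolding relay_f_def by simp

lemma relay_f_pos: "0 < relay_f u y"
  by (simp add: relay_f_def)

text \<open>One step of the change of measure: completing the square in the exponent shows that
  \<open>relay_f u\<close> is the density of a unit Gaussian centred at \<open>u\<close> relative to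
  the centred one.\<close>

lemma nn_integral_std_gaussian_shift:
  assumes [measurable]: "F \<in> borel_measurable borel"
  shows "(\<integral>\<^sup>+v. F (u + v) \<partial>std_gaussian) = (\<integral>\<^sup>+y. F y * ennreal (relay_f u y) \<partial>std_gaussian)"
proof -
  have *: "std_normal_density (y - u) = std_normal_density y * relay_f u y" for y
  proof -
    have "- (y - u)\<^sup>2 / 2 = - y\<^sup>2 / 2 + - (u\<^sup>2 - 2 * y * u) / 2"
      by (simp add: power2_diff divide_simps)
    then show ?thesis
      unfolding std_normal_density_def relay_f_def by (simp only: exp_add mult.assoc)
  qed
  have shifted: "ennreal (std_normal_density (y - u)) =
      ennreal (std_normal_density y) * ennreal (relay_f u y)" for y
    unfolding * by (rule ennreal_mult) (auto intro: less_imp_le relay_f_pos)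
  have "(\<integral>\<^sup>+y. F y * ennreal (relay_f u y) \<partial>std_gaussian) =
      (\<integral>\<^sup>+y. ennreal (std_normal_density (y - u)) * F y \<partial>lborel)"
    unfolding std_gaussian_def
    by (subst nn_integral_density)
      (auto intro!: nn_integral_cong simp: shifted mult_ac)
  \<comment> \<open>Substitution \<open>y = u + v\<close> in Lebesgue measure.\<close>
  also have "\<dots> = (\<integral>\<^sup>+v. ennreal (std_normal_density v) * F (u + v) \<partial>lborel)"
    by (subst nn_integral_real_affine[where c = 1 and t = u]) auto
  also have "\<dots> = (\<integral>\<^sup>+v. F (u + v) \<partial>std_gaussian)"
    unfolding std_gaussian_def by (subst nn_integral_density) auto
  finally show ?thesis ..
qed

lemma borel_measurable_component:
  "i \<in> I \<Longrightarrow> (\<lambda>z. z i) \<in> borel_measurable (PiM I (\<lambda>_. std_gaussian))"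
  using measurable_component_singleton[of i I "\<lambda>_. std_gaussian"]
  by (simp cong: measurable_cong_sets)

text \<open>
  For \<open>h = \<gamma>(0 := id)\<close> and noise \<open>\<xi> = (x, v\<^sup>0, \<dots>, v\<^sup>N\<^sup>-\<^sup>1)\<close> the chain lists \<open>x, y\<^sup>1, \<dots>, y\<^sup>N\<close>.
\<close>

primrec noisy_chain ::
  "(nat \<Rightarrow> real \<Rightarrow> real) \<Rightarrow> (nat \<Rightarrow> real) \<Rightarrow> nat \<Rightarrow> real" where
  "noisy_chain h \<xi> 0 = \<xi> 0"
| "noisy_chain h \<xi> (Suc i) = h i (noisy_chain h \<xi> i) + \<xi> (Suc i)"

lemma noisy_chain_cong:
  "(\<And>j. j \<le> i \<Longrightarrow> \<xi> j = \<xi>' j) \<Longrightarrow> noisy_chain h \<xi> i = noisy_chain h \<xi>' i"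
  by (induction i) auto

lemma borel_measurable_noisy_chain:
  assumes "\<And>i. i < n \<Longrightarrow> h i \<in> borel_measurable borel" "i \<le> n"
  shows "(\<lambda>\<xi>. noisy_chain h \<xi> i) \<in> borel_measurable (PiM {..n} (\<lambda>_. std_gaussian))"
  using assms(2)
proof (induction i)
  case 0
  then show ?case by simp measurable
next
  case (Suc i)
  have [measurable]: "h i \<in> borel_measurable borel"
    "(\<lambda>\<xi>. noisy_chain h \<xi> i) \<in> borel_measurable (PiM {..n} (\<lambda>_. std_gaussian))"
    using Suc assms by auto
  have [measurable]: "(\<lambda>\<xi>. \<xi> (Suc i)) \<in> borel_measurable (PiM {..n} (\<lambda>_. std_gaussian))"
    using Suc.prems by (intro borel_measurable_component) auto
  show ?case by simp
qed

text \<open>Induction on the length, peeling off the last noise. Given the earlier noises, the last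
  observation is a shifted Gaussian, so the one-step lemma applies. \<open>F\<close> must stay
  arbitrary, because the induction hypothesis is used for the function left after integrating out
  that observation.\<close>

lemma nn_integral_noisy_chain:
  assumes "\<And>i. i < n \<Longrightarrow> h i \<in> borel_measurable borel"
    and "F \<in> borel_measurable (PiM {..n} (\<lambda>_. std_gaussian))"
  shows "(\<integral>\<^sup>+\<xi>. F (\<lambda>i\<in>{..n}. noisy_chain h \<xi> i) \<partial>PiM {..n} (\<lambda>_. std_gaussian)) =
    (\<integral>\<^sup>+z. F z * ennreal (\<Prod>i<n. relay_f (h i (z i)) (z (Suc i))) \<partial>PiM {..n} (\<lambda>_. std_gaussian))"
  using assms
proof (induction n arbitrary: F)
  case 0
  have "(\<lambda>i\<in>{..0}. noisy_chain h \<xi> i) = \<xi>" if "\<xi> \<in> extensional {..0}" for \<xi>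
    using that by (auto simp: extensional_def fun_eq_iff)
  then have "F (\<lambda>i\<in>{..0}. noisy_chain h \<xi> i) = F \<xi>"
    if "\<xi> \<in> space (PiM {..0} (\<lambda>_. std_gaussian))" for \<xi>
    using that by (simp only: space_PiM PiE_def Int_iff)
  then show ?case
    by (intro nn_integral_cong) (simp only: lessThan_0 prod.empty ennreal_1 mult_1_right)
next
  case (Suc n)
  note [measurable] = Suc.prems(2)
  let ?G = "\<lambda>n. PiM {..n} (\<lambda>_ :: nat. std_gaussian)"
  \<comment> \<open>The last observation is integrated out under its reference law, tilted by
    \<open>relay_f\<close>; what remains depends on the first coordinates only and feeds the
    induction hypothesis.\<close>
  let ?F = "\<lambda>z. \<integral>\<^sup>+y. F (z(Suc n := y)) * ennreal (relay_f (h n (z n)) y) \<partial>std_gaussian"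
  have [measurable]: "h n \<in> borel_measurable borel" using Suc.prems by simp
  have upd [measurable]: "(\<lambda>(z, y). z(Suc n := y)) \<in> ?G n \<Otimes>\<^sub>M std_gaussian \<rightarrow>\<^sub>M ?G (Suc n)"
    using measurable_add_dim[of "Suc n" "{..n}" "\<lambda>_. std_gaussian"] by (simp add: atMost_Suc)
  have [measurable]: "(\<lambda>z. z n) \<in> borel_measurable (?G n)" by measurable
  have F [measurable]: "?F \<in> borel_measurable (?G n)" by measurable
  have prod [measurable]: "(\<lambda>z. \<Prod>i<Suc n. relay_f (h i (z i)) (z (Suc i)))
      \<in> borel_measurable (?G (Suc n))"
  proof (rule borel_measurable_prod)
    fix i assume i: "i \<in> {..<Suc n}"
    then have [measurable]: "h i \<in> borel_measurable borel" using Suc.prems by simp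
    have [measurable]: "(\<lambda>z. z i) \<in> borel_measurable (?G (Suc n))"
      "(\<lambda>z. z (Suc i)) \<in> borel_measurable (?G (Suc n))"
      using i by (auto intro!: borel_measurable_component)
    show "(\<lambda>z. relay_f (h i (z i)) (z (Suc i))) \<in> borel_measurable (?G (Suc n))"
      by measurable
  qed
  have chain [measurable]: "(\<lambda>\<xi>. \<lambda>i\<in>{..Suc n}. noisy_chain h \<xi> i) \<in> ?G (Suc n) \<rightarrow>\<^sub>M ?G (Suc n)"
    using borel_measurable_noisy_chain[of "Suc n" h] Suc.prems by (intro measurable_restrict) auto
  have split_last: "(\<integral>\<^sup>+z. f z \<partial>?G (Suc n)) = (\<integral>\<^sup>+z. \<integral>\<^sup>+y. f (z(Suc n := y)) \<partial>std_gaussian \<partial>?G n)"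
    if "f \<in> borel_measurable (?G (Suc n))" for f
    using gaussian_product.product_nn_integral_insert[of "{..n}" "Suc n" f] that
    by (simp add: atMost_Suc)
  \<comment> \<open>The last noise enters the last observation only: the relay is causal.\<close>
  have chain_upd: "(\<lambda>i\<in>{..Suc n}. noisy_chain h (\<xi>(Suc n := y)) i) =
      (\<lambda>i\<in>{..n}. noisy_chain h \<xi> i)(Suc n := h n (noisy_chain h \<xi> n) + y)" for \<xi> y
  proof -
    have "noisy_chain h (\<xi>(Suc n := y)) i = noisy_chain h \<xi> i" if "i \<le> n" for i
      using that by (intro noisy_chain_cong) auto
    then show ?thesis by (auto simp: fun_eq_iff)
  qed
  have "(\<integral>\<^sup>+\<xi>. F (\<lambda>i\<in>{..Suc n}. noisy_chain h \<xi> i) \<partial>?G (Suc n)) =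
      (\<integral>\<^sup>+\<xi>. \<integral>\<^sup>+y. F ((\<lambda>i\<in>{..n}. noisy_chain h \<xi> i)
        (Suc n := h n (noisy_chain h \<xi> n) + y)) \<partial>std_gaussian \<partial>?G n)"
    unfolding chain_upd[symmetric]
    by (rule split_last, rule measurable_compose[OF chain Suc.prems(2)])
  also have "\<dots> = (\<integral>\<^sup>+\<xi>. ?F (\<lambda>i\<in>{..n}. noisy_chain h \<xi> i) \<partial>?G n)"
  proof (rule nn_integral_cong)
    fix \<xi> assume "\<xi> \<in> space (?G n)"
    have "(\<lambda>i\<in>{..n}. noisy_chain h \<xi> i) \<in> space (?G n)" by (auto simp: space_PiM)
    then have upd_meas: "(\<lambda>y. F ((\<lambda>i\<in>{..n}. noisy_chain h \<xi> i)(Suc n := y))) \<in> borel_measurable borel"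
      by measurable
    show "(\<integral>\<^sup>+y. F ((\<lambda>i\<in>{..n}. noisy_chain h \<xi> i)
        (Suc n := h n (noisy_chain h \<xi> n) + y)) \<partial>std_gaussian) = ?F (\<lambda>i\<in>{..n}. noisy_chain h \<xi> i)"
      using nn_integral_std_gaussian_shift[OF upd_meas, of "h n (noisy_chain h \<xi> n)"]
      by (simp only: restrict_apply atMost_iff order_refl if_True)
  qed
  also have "\<dots> = (\<integral>\<^sup>+z. ?F z * ennreal (\<Prod>i<n. relay_f (h i (z i)) (z (Suc i))) \<partial>?G n)"
    using Suc.prems by (intro Suc.IH F) auto
  also have "\<dots> = (\<integral>\<^sup>+z. \<integral>\<^sup>+y. F (z(Suc n := y)) *
      ennreal (\<Prod>i<Suc n. relay_f (h i ((z(Suc n := y)) i)) ((z(Suc n := y)) (Suc i)))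
      \<partial>std_gaussian \<partial>?G n)"
  proof (rule nn_integral_cong)
    fix z assume "z \<in> space (?G n)"
    then have "(\<lambda>y. F (z(Suc n := y))) \<in> borel_measurable borel" by measurable
    then have meas: "(\<lambda>y. F (z(Suc n := y)) * ennreal (relay_f (h n (z n)) y))
        \<in> borel_measurable std_gaussian"
      unfolding measurable_cong_sets[OF sets_std_gaussian refl]
      by (intro borel_measurable_times_ennreal measurable_compose[OF _ measurable_ennreal]) auto
    have "(\<Prod>i<n. relay_f (h i ((z(Suc n := y)) i)) ((z(Suc n := y)) (Suc i))) =
        (\<Prod>i<n. relay_f (h i (z i)) (z (Suc i)))" for y
      by (intro prod.cong) auto
    note prod_upd = this
    have split: "ennreal (\<Prod>i<Suc n. relay_f (h i ((z(Suc n := y)) i)) ((z(Suc n := y)) (Suc i))) =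
        ennreal (relay_f (h n (z n)) y) * ennreal (\<Prod>i<n. relay_f (h i (z i)) (z (Suc i)))" for y
    proof -
      have "0 \<le> (\<Prod>i<n. relay_f (h i (z i)) (z (Suc i)))" "0 \<le> relay_f (h n (z n)) y"
        by (intro prod_nonneg less_imp_le[OF relay_f_pos] ballI)+
      then show ?thesis
        unfolding prod.lessThan_Suc prod_upd by (subst ennreal_mult'') (auto simp: mult.commute)
    qed
    show "?F z * ennreal (\<Prod>i<n. relay_f (h i (z i)) (z (Suc i))) =
      (\<integral>\<^sup>+y. F (z(Suc n := y)) *
        ennreal (\<Prod>i<Suc n. relay_f (h i ((z(Suc n := y)) i)) ((z(Suc n := y)) (Suc i))) \<partial>std_gaussian)"
      by (subst nn_integral_multc[OF meas, symmetric]) (simp_all only: split mult.assoc borel_measurable_const)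
  qed
  also have "\<dots> = (\<integral>\<^sup>+z. F z * ennreal (\<Prod>i<Suc n. relay_f (h i (z i)) (z (Suc i))) \<partial>?G (Suc n))"
    by (rule split_last[symmetric]) measurable
  finally show ?case .
qed

section \<open>Canonical noise space and the cost as an integral over i.i.d. observations\<close>

abbreviation noise_law :: "nat \<Rightarrow> (nat \<Rightarrow> real) measure" where
  "noise_law N \<equiv> PiM {..N} (\<lambda>_. std_gaussian)"

text \<open>Here \<open>noise_law N\<close> is the law of \<open>x\<close> and the noises. After the
  change of measure the same product law serves for the vector formed by \<open>x\<close> and the
  observations, with \<open>z 0\<close> in the role of \<open>x\<close>.\<close>

abbreviation canonical_J :: "nat \<Rightarrow> (nat \<Rightarrow> real) \<Rightarrow> (nat \<Rightarrow> real \<Rightarrow> real) \<Rightarrow> ennreal" where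
  "canonical_J N \<equiv> relay_J (noise_law N) (\<lambda>\<xi>. \<xi> 0) (\<lambda>i \<xi>. \<xi> (Suc i)) N"

lemma relay_cost_cong:
  "N \<ge> 1 \<Longrightarrow> (\<And>i. i \<in> {1..N} \<Longrightarrow> u i = u' i) \<Longrightarrow> relay_cost N w x u = relay_cost N w x u'"
  unfolding relay_cost_def by (auto intro!: sum.cong arg_cong2[where f = "(+)"])

lemma relay_cost_nonneg:
  "(\<And>i. i \<in> {1..<N} \<Longrightarrow> w i \<ge> 0) \<Longrightarrow> relay_cost N w x u \<ge> 0"
  unfolding relay_cost_def by (auto intro!: add_nonneg_nonneg sum_nonneg)

lemma borel_measurable_relay_cost:
  assumes "N \<ge> 1" "x \<in> borel_measurable M" "\<And>i. i \<in> {1..N} \<Longrightarrow> (\<lambda>\<omega>. u \<omega> i) \<in> borel_measurable M"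
  shows "(\<lambda>\<omega>. relay_cost N w (x \<omega>) (u \<omega>)) \<in> borel_measurable M"
  unfolding relay_cost_def using assms
  by (intro borel_measurable_add borel_measurable_power borel_measurable_diff borel_measurable_sum
    borel_measurable_times borel_measurable_const) auto

text \<open>Storing \<open>x\<close> as action number 0 turns the separate factor for the first
  agent into an ordinary factor, so that the weight has exactly the shape produced by
  \<open>nn_integral_noisy_chain\<close>.\<close>

lemma relay_ctilde_eq:
  assumes "N \<ge> 1"
  shows "relay_ctilde N w x y u =
    relay_cost N w x u * (\<Prod>i<N. relay_f ((u(0 := x)) i) (y (Suc i)))"
proof -
  obtain n where N: "N = Suc n" using assms by (cases N) auto
  have "(\<Prod>i\<in>{2..N}. relay_f (u (i - 1)) (y i)) = (\<Prod>i<n. relay_f (u (Suc i)) (y (Suc (Suc i))))"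
    by (rule prod.reindex_bij_witness[where i = "\<lambda>i. i + 2" and j = "\<lambda>i. i - 2"])
      (auto simp: N Suc_diff_Suc numeral_2_eq_2)
  then show ?thesis
    by (simp add: relay_ctilde_def N prod.lessThan_Suc_shift del: prod.lessThan_Suc)
qed

lemma relay_ctilde_nonneg:
  "(\<And>i. i \<in> {1..<N} \<Longrightarrow> w i \<ge> 0) \<Longrightarrow> relay_ctilde N w x y u \<ge> 0"
  unfolding relay_ctilde_def
  by (intro mult_nonneg_nonneg relay_cost_nonneg prod_nonneg) (auto intro: less_imp_le relay_f_pos)

lemma relay_ctilde_cong:
  assumes "N \<ge> 1" "\<And>i. i \<in> {1..N} \<Longrightarrow> y i = y' i" "\<And>i. i \<in> {1..N} \<Longrightarrow> u i = u' i"
  shows "relay_ctilde N w x y u = relay_ctilde N w x y' u'"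
proof -
  have "u (i - 1) = u' (i - 1)" if "i \<in> {2..N}" for i
    using that by (intro assms(3)) auto
  then show ?thesis
    unfolding relay_ctilde_def
    using assms by (intro arg_cong2[where f = "(*)"] relay_cost_cong prod.cong) auto
qed

lemma borel_measurable_relay_ctilde:
  assumes "N \<ge> 1" "x \<in> borel_measurable M"
    and "\<And>i. i \<in> {1..N} \<Longrightarrow> (\<lambda>\<omega>. y \<omega> i) \<in> borel_measurable M"
    and "\<And>i. i \<in> {1..N} \<Longrightarrow> (\<lambda>\<omega>. u \<omega> i) \<in> borel_measurable M"
  shows "(\<lambda>\<omega>. relay_ctilde N w (x \<omega>) (y \<omega>) (u \<omega>)) \<in> borel_measurable M"
proof -
  have "(\<lambda>\<omega>. u \<omega> (i - 1)) \<in> borel_measurable M" if "i \<in> {2..N}" for i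
    using that by (intro assms(4)) auto
  then show ?thesis
    unfolding relay_ctilde_def using assms
    by (intro borel_measurable_times borel_measurable_prod borel_measurable_relay_f
      borel_measurable_relay_cost) auto
qed

lemma borel_measurable_policy_component:
  assumes "\<gamma> \<in> borel_measurable borel" "i \<in> I"
  shows "(\<lambda>z. \<gamma> (z i)) \<in> borel_measurable (PiM I (\<lambda>_. std_gaussian))"
  using measurable_compose[OF borel_measurable_component assms(1)] assms(2) .

text \<open>Links the recursion over actions with the recursion over observations; the identity in
  position 0 passes \<open>x\<close> on as the action with index 0.\<close>

lemma relay_action_noisy_chain:
  "relay_action \<gamma> (\<xi> 0) (\<lambda>i. \<xi> (Suc i)) i = (\<gamma>(0 := id)) i (noisy_chain (\<gamma>(0 := id)) \<xi> i)"
  by (induction i) auto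

lemma borel_measurable_relay_action:
  assumes "\<And>i. i \<in> {1..N} \<Longrightarrow> \<gamma> i \<in> borel_measurable borel" "i \<le> N"
  shows "(\<lambda>\<xi>. relay_action \<gamma> (\<xi> 0) (\<lambda>i. \<xi> (Suc i)) i) \<in> borel_measurable (noise_law N)"
proof -
  have h: "(\<gamma>(0 := id)) j \<in> borel_measurable borel" if "j \<le> N" for j
    using assms that by (cases j) auto
  show ?thesis
    unfolding relay_action_noisy_chain
    by (rule measurable_compose[OF borel_measurable_noisy_chain h]) (auto intro: h assms)
qed

lemma borel_measurable_canonical_cost:
  assumes "N \<ge> 1" "\<And>i. i \<in> {1..N} \<Longrightarrow> \<gamma> i \<in> borel_measurable borel"
  shows "(\<lambda>\<xi>. relay_cost N w (\<xi> 0) (relay_action \<gamma> (\<xi> 0) (\<lambda>i. \<xi> (Suc i))))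
    \<in> borel_measurable (noise_law N)"
  using assms
  by (intro borel_measurable_relay_cost borel_measurable_component borel_measurable_relay_action) auto

text \<open>Independence says that the joint law is the product of the marginals, all of which are
  standard Gaussian.\<close>

lemma noise_law_eq_distr:
  fixes P :: "'a measure" and x :: "'a \<Rightarrow> real"
  assumes "prob_space P"
    and "distributed P lborel x (\<lambda>t. ennreal (std_normal_density t))"
    and "\<And>i. i < N \<Longrightarrow> distributed P lborel (v i) (\<lambda>t. ennreal (std_normal_density t))"
    and "prob_space.indep_vars P (\<lambda>_. borel) (case_nat x v) {..N}"
  shows "distr P (PiM {..N} (\<lambda>_. borel)) (\<lambda>\<omega>. \<lambda>i\<in>{..N}. case_nat x v i \<omega>) = noise_law N"
proof -
  interpret prob_space P by fact
  have dist: "distributed P lborel (case_nat x v i) (\<lambda>t. ennreal (std_normal_density t))"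
    if "i \<in> {..N}" for i
    using assms(2,3) that by (cases i) auto
  have rv: "case_nat x v i \<in> borel_measurable P" if "i \<in> {..N}" for i
    using distributed_measurable[OF dist[OF that]] by simp
  have distr: "distr P borel (case_nat x v i) = std_gaussian" if "i \<in> {..N}" for i
    using distributed_distr_eq_density[OF dist[OF that]]
    by (simp add: std_gaussian_def cong: distr_cong)
  have "distr P (PiM {..N} (\<lambda>_. borel)) (\<lambda>\<omega>. \<lambda>i\<in>{..N}. case_nat x v i \<omega>) =
      PiM {..N} (\<lambda>i. distr P borel (case_nat x v i))"
    using indep_vars_iff_distr_eq_PiM'[where I = "{..N}" and M' = "\<lambda>_. borel" and X = "case_nat x v"]
      rv assms(4) by auto
  also have "\<dots> = noise_law N" by (rule PiM_cong) (auto simp: distr)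
  finally show ?thesis .
qed

text \<open>The cost is a measurable function of \<open>x\<close> and the noises, so its expectation
  depends on their joint law alone; from here on the original probability space can be
  ignored.\<close>

lemma relay_J_eq_canonical_J:
  fixes P :: "'a measure" and x :: "'a \<Rightarrow> real"
  assumes "prob_space P" "N \<ge> 1"
    and "distributed P lborel x (\<lambda>t. ennreal (std_normal_density t))"
    and "\<And>i. i < N \<Longrightarrow> distributed P lborel (v i) (\<lambda>t. ennreal (std_normal_density t))"
    and "prob_space.indep_vars P (\<lambda>_. borel) (case_nat x v) {..N}"
    and "\<And>i. i \<in> {1..N} \<Longrightarrow> \<gamma> i \<in> borel_measurable borel"
  shows "relay_J P x v N w \<gamma> = canonical_J N w \<gamma>"
proof -
  interpret prob_space P by fact
  let ?X = "\<lambda>\<omega>. \<lambda>i\<in>{..N}. case_nat x v i \<omega>"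
  let ?c = "\<lambda>\<xi>. ennreal (relay_cost N w (\<xi> 0) (relay_action \<gamma> (\<xi> 0) (\<lambda>i. \<xi> (Suc i))))"
  have X: "?X \<in> P \<rightarrow>\<^sub>M PiM {..N} (\<lambda>_. borel)"
    using indep_vars_def2[where I = "{..N}" and M' = "\<lambda>_. borel" and X = "case_nat x v"] assms(5)
    by (intro measurable_restrict) auto
  have sets: "sets (noise_law N) = sets (PiM {..N} (\<lambda>_. borel))"
    by (rule sets_PiM_cong) auto
  have "?c \<in> borel_measurable (noise_law N)"
    using borel_measurable_canonical_cost[OF assms(2,6)] by measurable
  then have c: "?c \<in> borel_measurable (PiM {..N} (\<lambda>_. borel))"
    using measurable_cong_sets[OF sets refl] by blast
  have action: "relay_action \<gamma> (?X \<omega> 0) (\<lambda>i. ?X \<omega> (Suc i)) i = relay_action \<gamma> (x \<omega>) (\<lambda>i. v i \<omega>) i"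
    if "i \<le> N" for i \<omega>
    using that by (induction i) auto
  have "canonical_J N w \<gamma> = (\<integral>\<^sup>+\<xi>. ?c \<xi> \<partial>distr P (PiM {..N} (\<lambda>_. borel)) ?X)"
    by (subst noise_law_eq_distr[OF assms(1,3,4,5)]) (simp_all add: relay_J_def)
  also have "\<dots> = (\<integral>\<^sup>+\<omega>. ?c (?X \<omega>) \<partial>P)"
    by (subst nn_integral_distr[OF X]) (use c in simp_all)
  also have "\<dots> = relay_J P x v N w \<gamma>"
    unfolding relay_J_def using assms(2) action
    by (intro nn_integral_cong arg_cong[where f = ennreal])
      (auto simp: relay_cost_def intro!: sum.cong arg_cong2[where f = "(+)"] arg_cong[where f = "\<lambda>t. t\<^sup>2"])
  finally show ?thesis ..
qed

text \<open>The chain formula with \<open>\<gamma>(0 := id)\<close>: its weight is the density part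
  of \<open>relay_ctilde\<close>, and the observations become i.i.d. standard Gaussian whatever the
  policy is.\<close>

lemma canonical_J_eq_integral_ctilde:
  assumes "N \<ge> 1" "\<And>i. i \<in> {1..<N} \<Longrightarrow> w i \<ge> 0"
    and "\<And>i. i \<in> {1..N} \<Longrightarrow> \<gamma> i \<in> borel_measurable borel"
  shows "canonical_J N w \<gamma> =
    (\<integral>\<^sup>+z. ennreal (relay_ctilde N w (z 0) z (\<lambda>i. \<gamma> i (z i))) \<partial>noise_law N)"
proof -
  let ?h = "\<gamma>(0 := id)"
  let ?c = "\<lambda>z :: nat \<Rightarrow> real. ennreal (relay_cost N w (z 0) (\<lambda>i. ?h i (z i)))"
  have h: "?h j \<in> borel_measurable borel" if "j < N" for j
    using assms that by (cases j) auto
  have "(\<lambda>z. relay_cost N w (z 0) (\<lambda>i. ?h i (z i))) \<in> borel_measurable (noise_law N)"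
    using assms
    by (intro borel_measurable_relay_cost borel_measurable_policy_component
      borel_measurable_component) auto
  then have c: "?c \<in> borel_measurable (noise_law N)" by measurable
  have "canonical_J N w \<gamma> = (\<integral>\<^sup>+\<xi>. ?c (\<lambda>i\<in>{..N}. noisy_chain ?h \<xi> i) \<partial>noise_law N)"
    unfolding relay_J_def relay_action_noisy_chain
    by (intro nn_integral_cong arg_cong[where f = ennreal])
      (use assms(1) in \<open>auto intro!: relay_cost_cong\<close>)
  also have "\<dots> = (\<integral>\<^sup>+z. ?c z * ennreal (\<Prod>i<N. relay_f (?h i (z i)) (z (Suc i))) \<partial>noise_law N)"
    by (rule nn_integral_noisy_chain[OF h c])
  also have "\<dots> = (\<integral>\<^sup>+z. ennreal (relay_ctilde N w (z 0) z (\<lambda>i. \<gamma> i (z i))) \<partial>noise_law N)"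
  proof (rule nn_integral_cong)
    fix z :: "nat \<Rightarrow> real"
    have "relay_cost N w (z 0) (\<lambda>i. ?h i (z i)) = relay_cost N w (z 0) (\<lambda>i. \<gamma> i (z i))"
      using assms(1) by (intro relay_cost_cong) auto
    moreover have "(\<Prod>i<N. relay_f (?h i (z i)) (z (Suc i))) =
        (\<Prod>i<N. relay_f (((\<lambda>i. \<gamma> i (z i))(0 := z 0)) i) (z (Suc i)))"
      by (intro prod.cong) auto
    ultimately show "?c z * ennreal (\<Prod>i<N. relay_f (?h i (z i)) (z (Suc i))) =
        ennreal (relay_ctilde N w (z 0) z (\<lambda>i. \<gamma> i (z i)))"
      using relay_cost_nonneg[OF assms(2)]
      by (simp add: relay_ctilde_eq[OF assms(1)] ennreal_mult prod_nonneg relay_f_pos less_imp_le)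
  qed
  finally show ?thesis .
qed

section \<open>Quantization\<close>

text \<open>Replacing the definite description by a floor makes both measurability and the error
  estimate accessible.\<close>

lemma quantizer_eq:
  assumes "l > 0" "n \<ge> 1"
  shows "quantizer l n y =
    (if y \<notin> {-l..l} then 0
     else if y = l then quant_level l n n
     else quant_level l n (nat \<lfloor>(y + l) / (2 * l / real n)\<rfloor> + 1))"
proof (cases "y \<in> {-l..l} \<and> y \<noteq> l")
  case True
  \<comment> \<open>The position of \<open>y\<close> counted in cell widths from the left end; its
    cell has the index \<open>j\<close> with \<open>j - 1 \<le> t < j\<close>.\<close>
  define t where "t = (y + l) / (2 * l / real n)"
  define j where "j = nat \<lfloor>t\<rfloor> + 1"
  have y: "y + l = t * (2 * l / real n)" using assms by (simp add: t_def)
  have "0 \<le> t" unfolding t_def using True assms by (intro divide_nonneg_nonneg) auto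
  moreover have "t < real n" unfolding t_def using True assms by (simp add: divide_less_eq)
  ultimately have t: "0 \<le> t" "t < real n" .
  have j: "real j - 1 \<le> t" "t < real j" "j \<in> {1..n}"
    using t unfolding j_def by (auto simp: le_nat_floor) linarith+
  have "(real j - 1) * (2 * l / real n) \<le> y + l" "y + l < real j * (2 * l / real n)"
    unfolding y using j assms by (intro mult_right_mono mult_strict_right_mono; simp)+
  moreover have "quant_level l n j - l / real n = - l + (real j - 1) * (2 * l / real n)"
    "quant_level l n j + l / real n = - l + real j * (2 * l / real n)"
    unfolding quant_level_def by (simp_all only: left_diff_distrib)
  ultimately have "quantizer l n y = quant_level l n j"
    using assms(1) j(3) by (intro quantizer_cell) linarith+
  then show ?thesis using True by (simp add: j_def t_def)
qed (auto simp: quantizer_def)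

lemma quantizer_in_grid:
  assumes "l > 0" "n \<ge> 1"
  shows "quantizer l n y \<in> quant_grid l n"
proof -
  have "nat \<lfloor>(y + l) / (2 * l / real n)\<rfloor> + 1 \<in> {1..n}" if "y \<in> {-l..l}" "y \<noteq> l"
  proof -
    have "(y + l) / (2 * l / real n) < real n" using that assms by (simp add: field_simps)
    then show ?thesis using assms by auto linarith
  qed
  then show ?thesis
    using assms unfolding quantizer_eq[OF assms] quant_grid_def by auto
qed

lemma abs_quantizer_diff_le:
  assumes "l > 0" "n \<ge> 1" "\<bar>y\<bar> \<le> l"
  shows "\<bar>quantizer l n y - y\<bar> \<le> l / real n"
proof (cases "y = l")
  case True
  then show ?thesis
    using assms by (simp add: quantizer_eq quant_level_def field_simps)
next
  case False
  define t where "t = (y + l) / (2 * l / real n)"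
  have y: "y = t * (2 * l / real n) - l" using assms by (simp add: t_def)
  have t: "0 \<le> t" using assms by (auto simp: t_def)
  have "quantizer l n y = quant_level l n (nat \<lfloor>t\<rfloor> + 1)"
    unfolding t_def using False assms by (auto simp: quantizer_eq)
  then have "quantizer l n y - y = (real (nat \<lfloor>t\<rfloor>) + 1/2 - t) * (2 * l / real n)"
    using y unfolding quant_level_def by (simp only: of_nat_add of_nat_1 left_diff_distrib distrib_right)
  \<comment> \<open>A point differs from the midpoint of its cell by at most half a cell, as the
    fractional part of \<open>t\<close> lies in \<open>[0, 1)\<close>.\<close>
  also have "\<bar>\<dots>\<bar> \<le> (1/2) * (2 * l / real n)"
    unfolding abs_mult
  proof (intro mult_mono)
    show "\<bar>real (nat \<lfloor>t\<rfloor>) + 1 / 2 - t\<bar> \<le> 1 / 2" using t by linarith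
  qed (use assms in auto)
  finally show ?thesis by simp
qed

text \<open>Unlike the error bound this holds on the whole line, because the overflow value 0 never
  increases the modulus. It lets one majorant serve for all grids.\<close>

lemma abs_quantizer_le:
  assumes "l > 0" "n \<ge> 1"
  shows "\<bar>quantizer l n y\<bar> \<le> \<bar>y\<bar> + l / real n"
proof (cases "\<bar>y\<bar> \<le> l")
  case True
  then show ?thesis using abs_quantizer_diff_le[OF assms True] by linarith
next
  case False
  then have "quantizer l n y = 0" using assms by (auto simp: quantizer_eq)
  then show ?thesis using assms by simp
qed

lemma borel_measurable_quantizer [measurable]:
  assumes "l > 0" "n \<ge> 1"
  shows "quantizer l n \<in> borel_measurable borel"
  unfolding quantizer_eq[OF assms, abs_def] quant_level_def by measurable

lemma finite_quant_grid: "finite (quant_grid l n)"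
  by (simp add: quant_grid_def)

lemma measurable_quantizer_grid:
  assumes "l > 0" "n \<ge> 1"
  shows "quantizer l n \<in> borel \<rightarrow>\<^sub>M count_space (quant_grid l n)"
  using borel_measurable_quantizer[OF assms] quantizer_in_grid[OF assms]
  by (auto simp: measurable_count_space_eq2[OF finite_quant_grid] intro!: measurable_sets_borel)

text \<open>The map \<open>p\<close> is arbitrary: the quantizer is measurable into a finite
  discrete set, where every function is measurable.\<close>

lemma borel_measurable_quantized_policy:
  assumes "l > 0" "n \<ge> 1"
  shows "p \<circ> quantizer l n \<in> borel_measurable borel"
  using measurable_compose[OF measurable_quantizer_grid[OF assms], of p borel]
  by (simp add: comp_def)

text \<open>A grid vector carries the Gaussian mass of the box of observations quantized to it. The
  finite sum is therefore the integral of a function constant on these boxes, and the finite cost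
  becomes an integral against the same law as the true cost.\<close>

lemma relay_J_fin_eq:
  assumes "l > 0" "n \<ge> 1" "N \<ge> 1" "\<And>i. i \<in> {1..<N} \<Longrightarrow> w i \<ge> 0"
  shows "relay_J_fin l n N w \<pi> =
    (\<integral>\<^sup>+z. ennreal (relay_ctilde N w (z 0) (\<lambda>i. quantizer l n (z i)) (\<lambda>i. \<pi> i (quantizer l n (z i))))
      \<partial>noise_law N)"
proof -
  let ?q = "quantizer l n" and ?Z = "{1..N} \<rightarrow>\<^sub>E quant_grid l n"
  let ?G = "PiM {1..N} (\<lambda>_ :: nat. std_gaussian)"
  let ?F = "\<lambda>x z. relay_ctilde N w x z (\<lambda>i. \<pi> i (z i))"
  note q [measurable] = borel_measurable_quantizer[OF assms(1,2)]
  have fin: "finite ?Z" by (intro finite_PiE finite_quant_grid) auto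
  have F0: "?F x z \<ge> 0" for x z by (intro relay_ctilde_nonneg assms)
  \<comment> \<open>The box of observation vectors with quantized value \<open>z\<close>.\<close>
  define B where "B z = (\<Pi>\<^sub>E i\<in>{1..N}. ?q -` {z i})" for z
  have B [measurable]: "B z \<in> sets ?G" for z
    unfolding B_def by (intro sets_PiM_I_finite) (auto intro!: measurable_sets_borel[OF q])
  have emB: "emeasure ?G (B z) = ennreal (\<Prod>i\<in>{1..N}. measure (quant_law l n) {z i})"
    if "z \<in> ?Z" for z
  proof -
    have "emeasure ?G (B z) = (\<Prod>i\<in>{1..N}. emeasure std_gaussian (?q -` {z i}))"
      unfolding B_def
      by (intro gaussian_product.emeasure_PiM) (auto intro!: measurable_sets_borel[OF q])
    also have "\<dots> = (\<Prod>i\<in>{1..N}. ennreal (measure (quant_law l n) {z i}))"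
    proof (rule prod.cong)
      fix i assume i: "i \<in> {1..N}"
      have "measure (quant_law l n) {z i} = measure std_gaussian (?q -` {z i})"
        unfolding quant_law_def using that i measurable_quantizer_grid[OF assms(1,2)]
        by (subst measure_distr) (auto cong: measurable_cong_sets)
      then show "emeasure std_gaussian (?q -` {z i}) = ennreal (measure (quant_law l n) {z i})"
        by (simp add: std_gaussian.emeasure_eq_measure)
    qed simp
    finally show ?thesis by (simp add: prod_ennreal)
  qed
  have inner: "ennreal (\<Sum>z\<in>?Z. ?F x z * (\<Prod>i\<in>{1..N}. measure (quant_law l n) {z i})) =
      (\<integral>\<^sup>+y. ennreal (?F x (\<lambda>i. ?q (y i))) \<partial>?G)" for x
  proof -
    have "ennreal (\<Sum>z\<in>?Z. ?F x z * (\<Prod>i\<in>{1..N}. measure (quant_law l n) {z i})) =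
        (\<Sum>z\<in>?Z. ennreal (?F x z) * emeasure ?G (B z))"
      using emB F0 by (subst sum_ennreal[symmetric]) (simp_all add: ennreal_mult prod_nonneg)
    also have "\<dots> = (\<integral>\<^sup>+y. (\<Sum>z\<in>?Z. ennreal (?F x z) * indicator (B z) y) \<partial>?G)"
    proof -
      have "(\<integral>\<^sup>+y. (\<Sum>z\<in>?Z. ennreal (?F x z) * indicator (B z) y) \<partial>?G) =
          (\<Sum>z\<in>?Z. \<integral>\<^sup>+y. ennreal (?F x z) * indicator (B z) y \<partial>?G)"
        by (intro nn_integral_sum borel_measurable_times_ennreal borel_measurable_const
          borel_measurable_indicator B)
      then show ?thesis by (simp only: nn_integral_cmult_indicator[OF B])
    qed
    also have "\<dots> = (\<integral>\<^sup>+y. ennreal (?F x (\<lambda>i. ?q (y i))) \<partial>?G)"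
    proof (rule nn_integral_cong)
      fix y assume "y \<in> space ?G"
      then have ext: "y \<in> extensional {1..N}" by (auto simp: space_PiM PiE_def)
      \<comment> \<open>The boxes are disjoint and cover: exactly one summand survives at
        \<open>y\<close>, the one of its own quantized vector.\<close>
      define z0 where "z0 = (\<lambda>i\<in>{1..N}. ?q (y i))"
      have z0: "z0 \<in> ?Z" using quantizer_in_grid[OF assms(1,2)] by (auto simp: z0_def)
      have iff: "y \<in> B z \<longleftrightarrow> z = z0" if "z \<in> ?Z" for z
      proof -
        have "y \<in> B z \<longleftrightarrow> (\<forall>i\<in>{1..N}. z i = z0 i)"
          using ext by (auto simp: B_def z0_def PiE_iff)
        then show ?thesis using PiE_ext[OF that z0] by auto
      qed
      have "(\<Sum>z\<in>?Z. ennreal (?F x z) * indicator (B z) y) =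
          (\<Sum>z\<in>?Z. if z = z0 then ennreal (?F x z) else 0)"
        using iff by (intro sum.cong) (auto simp: indicator_def)
      also have "\<dots> = ennreal (?F x z0)" using fin z0 by simp
      also have "?F x z0 = ?F x (\<lambda>i. ?q (y i))"
        using assms(3) by (intro relay_ctilde_cong) (auto simp: z0_def)
      finally show "(\<Sum>z\<in>?Z. ennreal (?F x z) * indicator (B z) y) = ennreal (?F x (\<lambda>i. ?q (y i)))" .
    qed
    finally show ?thesis .
  qed
  let ?H = "\<lambda>z. ennreal (?F (z 0) (\<lambda>i. ?q (z i)))"
  \<comment> \<open>Coordinate 0 is \<open>x\<close>, which is not quantized; Tonelli splits it off
    from the observations.\<close>
  have I: "insert 0 {1..N} = {..N}" by auto
  have "(\<lambda>z. ?F (z 0) (\<lambda>i. ?q (z i))) \<in> borel_measurable (noise_law N)"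
    using assms(3) borel_measurable_quantized_policy[OF assms(1,2), unfolded comp_def]
    by (intro borel_measurable_relay_ctilde borel_measurable_component
      borel_measurable_policy_component[OF q]
      borel_measurable_policy_component[where \<gamma> = "\<lambda>y. \<pi> _ (?q y)"]) auto
  then have H: "?H \<in> borel_measurable (PiM (insert 0 {1..N}) (\<lambda>_. std_gaussian))"
    unfolding I by measurable
  have "(\<integral>\<^sup>+z. ?H z \<partial>noise_law N) = (\<integral>\<^sup>+x. \<integral>\<^sup>+y. ?H (y(0 := x)) \<partial>?G \<partial>std_gaussian)"
    unfolding I[symmetric] by (rule gaussian_product.product_nn_integral_insert_rev) (use H in auto)
  also have "\<dots> = (\<integral>\<^sup>+x. \<integral>\<^sup>+y. ennreal (?F x (\<lambda>i. ?q (y i))) \<partial>?G \<partial>std_gaussian)"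
  proof (intro nn_integral_cong)
    fix x y
    have "?F x (\<lambda>i. ?q ((y(0 := x)) i)) = ?F x (\<lambda>i. ?q (y i))"
      using assms(3) by (intro relay_ctilde_cong) auto
    then show "?H (y(0 := x)) = ennreal (?F x (\<lambda>i. ?q (y i)))" by simp
  qed
  also have "\<dots> = relay_J_fin l n N w \<pi>" unfolding relay_J_fin_def inner ..
  finally show ?thesis ..
qed

section \<open>Domination and convergence for bounded actions\<close>

text \<open>
  The minimizers of successive finite problems need not converge, so the integrands have no pointwise
  limit; only their difference tends to \<open>0\<close>. Boundedness makes this relation stable under products.
\<close>

definition asymp_close :: "(nat \<Rightarrow> real) \<Rightarrow> (nat \<Rightarrow> real) \<Rightarrow> bool" where
  "asymp_close X Y \<longleftrightarrow> (\<exists>B. \<forall>k. \<bar>Y k\<bar> \<le> B) \<and> (\<lambda>k. X k - Y k) \<longlonglongrightarrow> 0"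

lemma tendsto_null_mult_bounded:
  fixes X Y :: "nat \<Rightarrow> real"
  assumes "X \<longlonglongrightarrow> 0" "\<And>k. \<bar>Y k\<bar> \<le> B"
  shows "(\<lambda>k. X k * Y k) \<longlonglongrightarrow> 0"
proof (rule Lim_null_comparison)
  show "\<forall>\<^sub>F k in sequentially. norm (X k * Y k) \<le> \<bar>X k\<bar> * B"
    using assms(2) by (intro always_eventually allI) (auto simp: abs_mult intro: mult_left_mono)
  show "(\<lambda>k. \<bar>X k\<bar> * B) \<longlonglongrightarrow> 0"
    using tendsto_mult_left_zero[OF tendsto_rabs_zero[OF assms(1)]] .
qed

lemma asymp_close_const: "asymp_close (\<lambda>_. c) (\<lambda>_. c)"
  unfolding asymp_close_def by auto

lemma asymp_close_add:
  assumes "asymp_close X Y" "asymp_close X' Y'"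
  shows "asymp_close (\<lambda>k. X k + X' k) (\<lambda>k. Y k + Y' k)"
proof -
  obtain B B' where B: "\<And>k. \<bar>Y k\<bar> \<le> B" "\<And>k. \<bar>Y' k\<bar> \<le> B'"
    using assms unfolding asymp_close_def by blast
  have "\<bar>Y k + Y' k\<bar> \<le> B + B'" for k using B[of k] by linarith
  moreover have "(\<lambda>k. (X k - Y k) + (X' k - Y' k)) \<longlonglongrightarrow> 0 + 0"
    using assms unfolding asymp_close_def by (intro tendsto_add) auto
  ultimately show ?thesis unfolding asymp_close_def by (auto simp: algebra_simps)
qed

lemma asymp_close_mult:
  assumes "asymp_close X Y" "asymp_close X' Y'"
  shows "asymp_close (\<lambda>k. X k * X' k) (\<lambda>k. Y k * Y' k)"
proof -
  obtain B B' where B: "\<And>k. \<bar>Y k\<bar> \<le> B" "\<And>k. \<bar>Y' k\<bar> \<le> B'"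
    using assms unfolding asymp_close_def by blast
  have "\<bar>Y k * Y' k\<bar> \<le> B * B'" for k
    unfolding abs_mult using B[of k] by (intro mult_mono) auto
  \<comment> \<open>Expansion of \<open>X X' - Y Y'\<close> in the two differences, in which only
    \<open>Y\<close> and \<open>Y'\<close> occur undifferenced; these are bounded by
    definition.\<close>
  moreover have "(\<lambda>k. (X k - Y k) * (X' k - Y' k) + (X k - Y k) * Y' k + (X' k - Y' k) * Y k)
      \<longlonglongrightarrow> 0 + 0 + 0"
    using assms B unfolding asymp_close_def
    by (intro tendsto_add tendsto_mult_zero tendsto_null_mult_bounded) auto
  then have "(\<lambda>k. X k * X' k - Y k * Y' k) \<longlonglongrightarrow> 0" by (simp add: algebra_simps)
  ultimately show ?thesis unfolding asymp_close_def by blast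
qed

lemma asymp_close_sum:
  "finite I \<Longrightarrow> (\<And>i. i \<in> I \<Longrightarrow> asymp_close (X i) (Y i)) \<Longrightarrow>
    asymp_close (\<lambda>k. \<Sum>i\<in>I. X i k) (\<lambda>k. \<Sum>i\<in>I. Y i k)"
  by (induction I rule: finite_induct) (auto intro: asymp_close_const asymp_close_add)

lemma asymp_close_prod:
  "finite I \<Longrightarrow> (\<And>i. i \<in> I \<Longrightarrow> asymp_close (X i) (Y i)) \<Longrightarrow>
    asymp_close (\<lambda>k. \<Prod>i\<in>I. X i k) (\<lambda>k. \<Prod>i\<in>I. Y i k)"
  by (induction I rule: finite_induct) (auto intro: asymp_close_const asymp_close_mult)

lemma asymp_close_exp:
  assumes "asymp_close X Y"
  shows "asymp_close (\<lambda>k. exp (X k)) (\<lambda>k. exp (Y k))"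
proof -
  obtain B where B: "\<And>k. \<bar>Y k\<bar> \<le> B" using assms unfolding asymp_close_def by blast
  have bound: "\<bar>exp (Y k)\<bar> \<le> exp B" for k using B[of k] by simp
  \<comment> \<open>Factoring out \<open>exp (Y k)\<close>, which is bounded, leaves a continuous
    function of the difference.\<close>
  have "(\<lambda>k. exp (X k - Y k) - 1) \<longlonglongrightarrow> exp 0 - 1"
    using assms unfolding asymp_close_def by (intro tendsto_intros) auto
  then have "(\<lambda>k. (exp (X k - Y k) - 1) * exp (Y k)) \<longlonglongrightarrow> 0"
    using bound by (intro tendsto_null_mult_bounded) auto
  moreover have "(exp (X k - Y k) - 1) * exp (Y k) = exp (X k) - exp (Y k)" for k
    by (simp add: left_diff_distrib mult_exp_exp)
  ultimately have "(\<lambda>k. exp (X k) - exp (Y k)) \<longlonglongrightarrow> 0" by simp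
  then show ?thesis unfolding asymp_close_def using bound by blast
qed

lemma asymp_close_relay_f:
  assumes "asymp_close U U'" "asymp_close Y Y'"
  shows "asymp_close (\<lambda>k. relay_f (U k) (Y k)) (\<lambda>k. relay_f (U' k) (Y' k))"
proof -
  \<comment> \<open>Written with products, sums and \<open>exp\<close> only, so that the closure
    rules apply.\<close>
  have eq: "relay_f u y = exp (u * (y + (- 1 / 2) * u))" for u y
    unfolding relay_f_def by (simp add: power2_eq_square diff_divide_distrib right_diff_distrib distrib_left)
  show ?thesis
    unfolding eq using assms
    by (intro asymp_close_exp asymp_close_mult asymp_close_add asymp_close_const)
qed

lemma asymp_close_relay_ctilde:
  assumes "N \<ge> 1"
    and "\<And>i. i \<in> {1..N} \<Longrightarrow> asymp_close (\<lambda>k. Y k i) (\<lambda>k. Y' k i)"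
    and "\<And>i. i \<in> {1..N} \<Longrightarrow> asymp_close (\<lambda>k. U k i) (\<lambda>k. U' k i)"
  shows "asymp_close (\<lambda>k. relay_ctilde N w x (Y k) (U k)) (\<lambda>k. relay_ctilde N w x (Y' k) (U' k))"
proof -
  have U: "asymp_close (\<lambda>k. U k (i - 1)) (\<lambda>k. U' k (i - 1))" if "i \<in> {2..N}" for i
    using that by (intro assms(3)) auto
  show ?thesis
    unfolding relay_ctilde_def relay_cost_def power2_eq_square diff_conv_add_uminus
    by (intro asymp_close_mult asymp_close_add asymp_close_sum asymp_close_prod
      asymp_close_relay_f asymp_close_const assms(2,3) U) (use assms(1) in auto)
qed

section \<open>Gaussian-integrable majorants for bounded actions\<close>

lemma relay_f_le_exp:
  assumes "\<bar>u\<bar> \<le> m" "\<bar>y\<bar> \<le> \<bar>z\<bar> + 1"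
  shows "relay_f u y \<le> exp (m + m\<^sup>2) * exp (3 / 8 * z\<^sup>2)"
proof -
  \<comment> \<open>The squares and the product are abstracted to leave linear arithmetic. The
    square \<open>(3|z| - 4m)^2\<close> gives \<open>|z| m \<le> 3/8 z^2 + 2/3 m^2\<close>; the
    coefficient 3/8 stays below the 1/2 of the Gaussian exponent.\<close>
  have linear: "- (U - 2 * s) / 2 \<le> (m + M) + 3 / 8 * Z"
    if "s \<le> p + m" "24 * p \<le> 9 * Z + 16 * M" "0 \<le> U" "0 \<le> M" for s p U M Z :: real
    using that by (simp add: field_simps)
  have "y * u \<le> \<bar>y\<bar> * \<bar>u\<bar>" by (metis abs_mult abs_ge_self)
  also have "\<dots> \<le> (\<bar>z\<bar> + 1) * m" using assms by (intro mult_mono) auto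
  finally have "y * u \<le> \<bar>z\<bar> * m + m" by (simp add: distrib_right)
  moreover have "0 \<le> (3 * \<bar>z\<bar> - 4 * m)\<^sup>2" by simp
  then have "24 * (\<bar>z\<bar> * m) \<le> 9 * z\<^sup>2 + 16 * m\<^sup>2" by (simp add: power2_diff power_mult_distrib mult_ac)
  moreover have "0 \<le> u\<^sup>2" "0 \<le> m\<^sup>2" by auto
  ultimately have "- (u\<^sup>2 - 2 * y * u) / 2 \<le> (m + m\<^sup>2) + 3 / 8 * z\<^sup>2"
    unfolding mult.assoc by (rule linear)
  then show ?thesis unfolding relay_f_def exp_add[symmetric] by simp
qed

text \<open>The factor of the first agent needs more care because \<open>x\<close> is unbounded. The
  quadratic cost costs only \<open>exp (x^2 / 8)\<close>, and the term \<open>- x^2 / 2\<close> in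
  the exponent of \<open>relay_f\<close> pays for it and for most of the cross term, leaving at most
  3/8 for each variable.\<close>

lemma mult_relay_f_le_exp:
  assumes "c \<le> 2 * x\<^sup>2 + A" "A \<ge> 0" "\<bar>y\<bar> \<le> \<bar>z\<bar> + 1"
  shows "c * relay_f x y \<le> (16 + A) * exp 6 * (exp (3 / 8 * x\<^sup>2) * exp (3 / 8 * z\<^sup>2))"
proof -
  have "x\<^sup>2 / 8 \<le> exp (x\<^sup>2 / 8)" using exp_ge_add_one_self[of "x\<^sup>2 / 8"] by linarith
  moreover have "A * 1 \<le> A * exp (x\<^sup>2 / 8)" using assms(2) by (intro mult_left_mono) auto
  ultimately have c: "c \<le> (16 + A) * exp (x\<^sup>2 / 8)" using assms(1) by (simp add: algebra_simps)
  have linear: "- (X - 2 * s) / 2 + X / 8 \<le> 6 + (3 / 8 * X + 3 / 8 * Z)"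
    if "s \<le> p + a" "24 * p \<le> 9 * Z + 16 * X" "24 * a \<le> X + 144" "0 \<le> X"
    for s p a X Z :: real
    using that by (simp add: field_simps)
  have "y * x \<le> \<bar>y\<bar> * \<bar>x\<bar>" by (metis abs_mult abs_ge_self)
  also have "\<dots> \<le> (\<bar>z\<bar> + 1) * \<bar>x\<bar>" using assms by (intro mult_right_mono) auto
  finally have "y * x \<le> \<bar>z\<bar> * \<bar>x\<bar> + \<bar>x\<bar>" by (simp add: algebra_simps)
  \<comment> \<open>The first square handles the cross term. The second gives
    \<open>|x| \<le> x^2 / 24 + 6\<close>, the source of the constant \<open>exp 6\<close>.\<close>
  moreover have "0 \<le> (3 * \<bar>z\<bar> - 4 * \<bar>x\<bar>)\<^sup>2" "0 \<le> (\<bar>x\<bar> - 12)\<^sup>2" by simp_all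
  then have "24 * (\<bar>z\<bar> * \<bar>x\<bar>) \<le> 9 * z\<^sup>2 + 16 * x\<^sup>2" "24 * \<bar>x\<bar> \<le> x\<^sup>2 + 144"
    by (simp_all add: power2_diff power_mult_distrib mult_ac)
  ultimately have "- (x\<^sup>2 - 2 * y * x) / 2 + x\<^sup>2 / 8 \<le> 6 + (3 / 8 * x\<^sup>2 + 3 / 8 * z\<^sup>2)"
    unfolding mult.assoc by (intro linear) simp_all
  then have e: "exp (x\<^sup>2 / 8) * relay_f x y \<le> exp 6 * (exp (3 / 8 * x\<^sup>2) * exp (3 / 8 * z\<^sup>2))"
    unfolding relay_f_def mult_exp_exp by simp
  have "c * relay_f x y \<le> (16 + A) * (exp (x\<^sup>2 / 8) * relay_f x y)"
    using mult_right_mono[OF c less_imp_le[OF relay_f_pos]] by (simp add: mult.assoc)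
  also have "\<dots> \<le> (16 + A) * (exp 6 * (exp (3 / 8 * x\<^sup>2) * exp (3 / 8 * z\<^sup>2)))"
    using e assms(2) by (intro mult_left_mono) auto
  finally show ?thesis by (simp add: mult.assoc)
qed

lemma relay_cost_le:
  assumes "N \<ge> 1" "m \<ge> 0" "\<And>i. i \<in> {1..<N} \<Longrightarrow> w i \<ge> 0" "\<And>i. i \<in> {1..N} \<Longrightarrow> \<bar>u i\<bar> \<le> m"
  shows "relay_cost N w x u \<le> 2 * x\<^sup>2 + (2 + sum w {1..<N}) * m\<^sup>2"
proof -
  have sq: "(u i)\<^sup>2 \<le> m\<^sup>2" if "i \<in> {1..N}" for i
    using power_mono[OF assms(4)[OF that], of 2] by simp
  have "0 \<le> (u N + x)\<^sup>2" by simp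
  then have "(u N - x)\<^sup>2 \<le> 2 * x\<^sup>2 + 2 * (u N)\<^sup>2" by (simp add: power2_diff power2_sum)
  moreover have "(\<Sum>i\<in>{1..<N}. w i * (u i)\<^sup>2) \<le> (\<Sum>i\<in>{1..<N}. w i * m\<^sup>2)"
    using assms(3) sq by (intro sum_mono mult_left_mono) auto
  ultimately show ?thesis
    unfolding relay_cost_def using sq[of N] assms(1)
    by (simp add: sum_distrib_right distrib_right)
qed

text \<open>One constant for all actions bounded by \<open>m\<close> and all observations
  \<open>y\<close> that exceed \<open>z\<close> in modulus by at most 1. The majorant sees
  \<open>z\<close> only, so it also dominates integrands evaluated at quantized
  observations.\<close>

lemma relay_ctilde_le_exp:
  assumes "N \<ge> 1" "m \<ge> 0" "\<And>i. i \<in> {1..<N} \<Longrightarrow> w i \<ge> 0"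
  shows "\<exists>K\<ge>0. \<forall>y z u. (\<forall>i\<in>{1..N}. \<bar>u i\<bar> \<le> m \<and> \<bar>y i\<bar> \<le> \<bar>z i\<bar> + 1) \<longrightarrow>
    relay_ctilde N w (z 0) y u \<le> K * (\<Prod>i\<le>N. exp (3 / 8 * (z i)\<^sup>2))"
proof -
  define A where "A = (2 + sum w {1..<N}) * m\<^sup>2"
  have A: "A \<ge> 0" using assms(3) by (auto simp: A_def intro!: mult_nonneg_nonneg add_nonneg_nonneg sum_nonneg)
  let ?K = "(16 + A) * exp 6 * (\<Prod>i\<in>{2..N}. exp (m + m\<^sup>2))"
  let ?e = "\<lambda>t :: real. exp (3 / 8 * t\<^sup>2)"
  have "relay_ctilde N w (z 0) y u \<le> ?K * (\<Prod>i\<le>N. ?e (z i))"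
    if u: "\<And>i. i \<in> {1..N} \<Longrightarrow> \<bar>u i\<bar> \<le> m" and y: "\<And>i. i \<in> {1..N} \<Longrightarrow> \<bar>y i\<bar> \<le> \<bar>z i\<bar> + 1"
    for y z u :: "nat \<Rightarrow> real"
  proof -
    have "relay_cost N w (z 0) u * relay_f (z 0) (y 1) \<le> (16 + A) * exp 6 * (?e (z 0) * ?e (z 1))"
      using relay_cost_le[OF assms u] A y assms(1) by (intro mult_relay_f_le_exp) (auto simp: A_def)
    moreover have "relay_f (u (i - 1)) (y i) \<le> exp (m + m\<^sup>2) * ?e (z i)" if "i \<in> {2..N}" for i
      using that by (intro relay_f_le_exp u y) auto
    then have "(\<Prod>i\<in>{2..N}. relay_f (u (i - 1)) (y i)) \<le> (\<Prod>i\<in>{2..N}. exp (m + m\<^sup>2) * ?e (z i))"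
      by (intro prod_mono) (auto intro: less_imp_le relay_f_pos)
    ultimately have "relay_ctilde N w (z 0) y u \<le>
        (16 + A) * exp 6 * (?e (z 0) * ?e (z 1)) * (\<Prod>i\<in>{2..N}. exp (m + m\<^sup>2) * ?e (z i))"
      unfolding relay_ctilde_def
      by (rule mult_mono) (use A in \<open>auto intro!: prod_nonneg less_imp_le[OF relay_f_pos]\<close>)
    also have "\<dots> = ?K * (?e (z 0) * ?e (z 1) * (\<Prod>i\<in>{2..N}. ?e (z i)))"
      unfolding prod.distrib by (simp only: mult_ac)
    also have "?e (z 0) * ?e (z 1) * (\<Prod>i\<in>{2..N}. ?e (z i)) = (\<Prod>i\<le>N. ?e (z i))"
    proof -
      have "{..N} = insert 0 (insert 1 {2..N})" using assms(1) by auto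
      then show ?thesis by (simp add: mult.assoc)
    qed
    finally show ?thesis .
  qed
  moreover have "?K \<ge> 0" using A by (intro mult_nonneg_nonneg prod_nonneg) auto
  ultimately show ?thesis by (intro exI[of _ ?K]) auto
qed

lemma nn_integral_exp_square_finite:
  "(\<integral>\<^sup>+t. ennreal (exp (3 / 8 * t\<^sup>2)) \<partial>std_gaussian) < \<infinity>"
proof -
  \<comment> \<open>Since 1/2 - 3/8 = 1/8, the product is a multiple of the density with standard
    deviation 2.\<close>
  have eq: "std_normal_density t * exp (3 / 8 * t\<^sup>2) = 2 * normal_density 0 2 t" for t :: real
  proof -
    have "- t\<^sup>2 / 2 + 3 / 8 * t\<^sup>2 = - t\<^sup>2 / 8" by simp
    then have "exp (- t\<^sup>2 / 2) * exp (3 / 8 * t\<^sup>2) = exp (- t\<^sup>2 / 8)" by (simp only: mult_exp_exp)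
    moreover have "sqrt (2 * pi * 2\<^sup>2) = 2 * sqrt (2 * pi)" by (simp only: real_sqrt_mult real_sqrt_abs abs_numeral mult.commute)
    ultimately show ?thesis
      unfolding normal_density_def by (simp add: mult.assoc)
  qed
  have eq': "ennreal (std_normal_density t) * ennreal (exp (3 / 8 * t\<^sup>2)) =
      ennreal (2 * normal_density 0 2 t)" for t :: real
    unfolding eq[symmetric] by (subst ennreal_mult) auto
  have "(\<integral>\<^sup>+t. ennreal (exp (3 / 8 * t\<^sup>2)) \<partial>std_gaussian) =
      (\<integral>\<^sup>+t. ennreal (2 * normal_density 0 2 t) \<partial>lborel)"
    unfolding std_gaussian_def
    by (subst nn_integral_density, measurable) (simp_all only: eq')
  also have "\<dots> < \<infinity>"
    by (subst nn_integral_eq_integral) (auto simp: normal_density_nonneg)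
  finally show ?thesis .
qed

lemma borel_measurable_exp_square_component:
  assumes "i \<le> N"
  shows "(\<lambda>z. exp (3 / 8 * (z i)\<^sup>2)) \<in> borel_measurable (noise_law N)"
proof -
  have [measurable]: "(\<lambda>z. z i) \<in> borel_measurable (noise_law N)"
    using assms by (intro borel_measurable_component) auto
  show ?thesis by measurable
qed

lemma nn_integral_prod_exp_square_finite:
  assumes "K \<ge> 0"
  shows "(\<integral>\<^sup>+z. ennreal (K * (\<Prod>i\<le>N. exp (3 / 8 * (z i)\<^sup>2))) \<partial>noise_law N) < \<infinity>"
proof -
  have "(\<integral>\<^sup>+z. ennreal (K * (\<Prod>i\<le>N. exp (3 / 8 * (z i)\<^sup>2))) \<partial>noise_law N) =
      (\<integral>\<^sup>+z. ennreal K * (\<Prod>i\<le>N. ennreal (exp (3 / 8 * (z i)\<^sup>2))) \<partial>noise_law N)"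
    using assms by (intro nn_integral_cong) (simp add: ennreal_mult prod_nonneg prod_ennreal)
  also have "\<dots> = ennreal K * (\<integral>\<^sup>+z. (\<Prod>i\<le>N. ennreal (exp (3 / 8 * (z i)\<^sup>2))) \<partial>noise_law N)"
    by (intro nn_integral_cmult borel_measurable_prod_ennreal
      measurable_compose[OF _ measurable_ennreal] borel_measurable_exp_square_component) auto
  also have "\<dots> = ennreal K * (\<Prod>i\<le>N. \<integral>\<^sup>+t. ennreal (exp (3 / 8 * t\<^sup>2)) \<partial>std_gaussian)"
  proof -
    have "(\<lambda>t. ennreal (exp (3 / 8 * t\<^sup>2))) \<in> borel_measurable std_gaussian" by measurable
    then show ?thesis by (subst gaussian_product.product_nn_integral_prod) simp_all
  qed
  also have "\<dots> < \<infinity>"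
    using nn_integral_exp_square_finite
    by (simp add: ennreal_mult_less_top power_less_top_ennreal)
  finally show ?thesis .
qed

text \<open>Dominated convergence for the difference of integrands. The map \<open>r\<close>
  perturbs the observations inside the density; \<open>\<alpha>\<close> and \<open>\<beta>\<close>
  are two bounded policy sequences that approach each other almost everywhere and need not converge
  themselves.\<close>

lemma tendsto_integral_ctilde_diff:
  assumes "N \<ge> 1" "m \<ge> 0" "\<And>i. i \<in> {1..<N} \<Longrightarrow> w i \<ge> 0"
    and r: "\<And>k. r k \<in> borel_measurable borel" "\<And>k t. \<bar>r k t\<bar> \<le> \<bar>t\<bar> + 1"
      "\<And>t. (\<lambda>k. r k t) \<longlonglongrightarrow> t"
    and \<alpha>: "\<And>k i. i \<in> {1..N} \<Longrightarrow> \<alpha> k i \<in> borel_measurable borel"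
      "\<And>k i t. i \<in> {1..N} \<Longrightarrow> \<bar>\<alpha> k i t\<bar> \<le> m"
    and \<beta>: "\<And>k i. i \<in> {1..N} \<Longrightarrow> \<beta> k i \<in> borel_measurable borel"
      "\<And>k i t. i \<in> {1..N} \<Longrightarrow> \<bar>\<beta> k i t\<bar> \<le> m"
    and \<alpha>\<beta>: "\<And>i. i \<in> {1..N} \<Longrightarrow> AE t in std_gaussian. (\<lambda>k. \<alpha> k i t - \<beta> k i t) \<longlonglongrightarrow> 0"
  shows "(\<lambda>k. \<integral>\<^sup>+z. ennreal \<bar>relay_ctilde N w (z 0) (\<lambda>i. r k (z i)) (\<lambda>i. \<alpha> k i (z i)) -
      relay_ctilde N w (z 0) z (\<lambda>i. \<beta> k i (z i))\<bar> \<partial>noise_law N) \<longlonglongrightarrow> 0"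
proof -
  let ?A = "\<lambda>k z. relay_ctilde N w (z 0) (\<lambda>i. r k (z i)) (\<lambda>i. \<alpha> k i (z i))"
  let ?B = "\<lambda>k z. relay_ctilde N w (z 0) z (\<lambda>i. \<beta> k i (z i))"
  obtain K where K: "K \<ge> 0" and le: "\<And>y z u. (\<forall>i\<in>{1..N}. \<bar>u i\<bar> \<le> m \<and> \<bar>y i\<bar> \<le> \<bar>z i\<bar> + 1) \<Longrightarrow>
      relay_ctilde N w (z 0) y u \<le> K * (\<Prod>i\<le>N. exp (3 / 8 * (z i)\<^sup>2))"
    using relay_ctilde_le_exp[where N = N and w = w, OF assms(1-3)] by auto
  let ?D = "\<lambda>z :: nat \<Rightarrow> real. K * (\<Prod>i\<le>N. exp (3 / 8 * (z i)\<^sup>2))"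
  have [measurable]: "?D \<in> borel_measurable (noise_law N)"
    by (intro borel_measurable_times borel_measurable_const borel_measurable_prod
      borel_measurable_exp_square_component) auto
  have [measurable]: "?A k \<in> borel_measurable (noise_law N)" "?B k \<in> borel_measurable (noise_law N)" for k
    using assms(1) r(1) \<alpha>(1) \<beta>(1)
    by (intro borel_measurable_relay_ctilde borel_measurable_component
      borel_measurable_policy_component; simp)+
  have "(\<lambda>k. \<integral>\<^sup>+z. ennreal \<bar>?A k z - ?B k z\<bar> \<partial>noise_law N) \<longlonglongrightarrow> (\<integral>\<^sup>+z. 0 \<partial>noise_law N)"
  proof (rule nn_integral_dominated_convergence[where w = "\<lambda>z. ennreal (?D z)"])
    show "AE z in noise_law N. ennreal \<bar>?A k z - ?B k z\<bar> \<le> ennreal (?D z)" for k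
    proof (intro AE_I2 ennreal_leI)
      fix z
      have "?A k z \<le> ?D z" "?B k z \<le> ?D z" by (intro le ballI conjI r(2) \<alpha>(2) \<beta>(2); simp)+
      moreover have "0 \<le> ?A k z" "0 \<le> ?B k z" using assms(3) by (auto intro!: relay_ctilde_nonneg)
      ultimately show "\<bar>?A k z - ?B k z\<bar> \<le> ?D z" by linarith
    qed
    show "(\<integral>\<^sup>+z. ennreal (?D z) \<partial>noise_law N) < \<infinity>"
      by (rule nn_integral_prod_exp_square_finite[OF K])
    have "AE z in noise_law N. \<forall>i\<in>{1..N}. (\<lambda>k. \<alpha> k i (z i) - \<beta> k i (z i)) \<longlonglongrightarrow> 0"
    proof (intro AE_finite_allI ballI)
      fix i assume "i \<in> {1..N}"
      then show "AE z in noise_law N. (\<lambda>k. \<alpha> k i (z i) - \<beta> k i (z i)) \<longlonglongrightarrow> 0"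
        by (intro AE_PiM_component[where M = "\<lambda>_. std_gaussian"] prob_space_std_gaussian \<alpha>\<beta>) auto
    qed simp
    then show "AE z in noise_law N. (\<lambda>k. ennreal \<bar>?A k z - ?B k z\<bar>) \<longlonglongrightarrow> 0"
    proof eventually_elim
      case (elim z)
      have "asymp_close (\<lambda>k. ?A k z) (\<lambda>k. ?B k z)"
      proof (intro asymp_close_relay_ctilde assms(1))
        fix i assume i: "i \<in> {1..N}"
        have "(\<lambda>k. r k (z i) - z i) \<longlonglongrightarrow> z i - z i" by (intro tendsto_intros r(3))
        then show "asymp_close (\<lambda>k. r k (z i)) (\<lambda>k. z i)" unfolding asymp_close_def by auto
        show "asymp_close (\<lambda>k. \<alpha> k i (z i)) (\<lambda>k. \<beta> k i (z i))"
          unfolding asymp_close_def using elim i \<beta>(2)[OF i] by blast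
      qed
      then have "(\<lambda>k. \<bar>?A k z - ?B k z\<bar>) \<longlonglongrightarrow> 0"
        unfolding asymp_close_def by (simp add: tendsto_rabs_zero_iff)
      then show ?case using tendsto_ennrealI[of _ 0] by force
    qed
  qed measurable
  then show ?thesis by simp
qed

text \<open>Convergence in L1 brings the integrals together. Closeness is stated by two inequalities
  with a summand, as subtraction is awkward for extended nonnegative values.\<close>

lemma eventually_nn_integral_le_add:
  assumes "\<And>k. A k \<in> borel_measurable M" "\<And>k. B k \<in> borel_measurable M"
    and "\<And>k z. 0 \<le> A k z" "\<And>k z. 0 \<le> B k z"
    and lim: "(\<lambda>k. \<integral>\<^sup>+z. ennreal \<bar>A k z - B k z\<bar> \<partial>M) \<longlonglongrightarrow> 0" and "\<delta> > 0"
  shows "\<forall>\<^sub>F k in sequentially.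
    (\<integral>\<^sup>+z. ennreal (A k z) \<partial>M) \<le> (\<integral>\<^sup>+z. ennreal (B k z) \<partial>M) + ennreal \<delta> \<and>
    (\<integral>\<^sup>+z. ennreal (B k z) \<partial>M) \<le> (\<integral>\<^sup>+z. ennreal (A k z) \<partial>M) + ennreal \<delta>"
proof -
  note [measurable] = assms(1,2)
  have le: "(\<integral>\<^sup>+z. ennreal (F z) \<partial>M) \<le>
      (\<integral>\<^sup>+z. ennreal (G z) \<partial>M) + (\<integral>\<^sup>+z. ennreal \<bar>F z - G z\<bar> \<partial>M)"
    if [measurable]: "F \<in> borel_measurable M" "G \<in> borel_measurable M" and "\<And>z. 0 \<le> G z" for F G :: "_ \<Rightarrow> real"
  proof -
    have "(\<integral>\<^sup>+z. ennreal (F z) \<partial>M) \<le> (\<integral>\<^sup>+z. ennreal (G z) + ennreal \<bar>F z - G z\<bar> \<partial>M)"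
      using that(3) by (intro nn_integral_mono) (simp flip: ennreal_plus add: ennreal_leI)
    also have "\<dots> = (\<integral>\<^sup>+z. ennreal (G z) \<partial>M) + (\<integral>\<^sup>+z. ennreal \<bar>F z - G z\<bar> \<partial>M)"
      by (intro nn_integral_add) auto
    finally show ?thesis .
  qed
  have "\<forall>\<^sub>F k in sequentially. (\<integral>\<^sup>+z. ennreal \<bar>A k z - B k z\<bar> \<partial>M) < ennreal \<delta>"
    using order_tendstoD(2)[OF lim, of "ennreal \<delta>"] assms(6) by simp
  then show ?thesis
  proof eventually_elim
    case (elim k)
    have sym: "(\<integral>\<^sup>+z. ennreal \<bar>B k z - A k z\<bar> \<partial>M) = (\<integral>\<^sup>+z. ennreal \<bar>A k z - B k z\<bar> \<partial>M)"
      by (simp only: abs_minus_commute[of "B k _"])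
    have "(\<integral>\<^sup>+z. ennreal (A k z) \<partial>M) \<le>
        (\<integral>\<^sup>+z. ennreal (B k z) \<partial>M) + (\<integral>\<^sup>+z. ennreal \<bar>A k z - B k z\<bar> \<partial>M)"
      by (intro le assms)
    moreover have "(\<integral>\<^sup>+z. ennreal (B k z) \<partial>M) \<le>
        (\<integral>\<^sup>+z. ennreal (A k z) \<partial>M) + (\<integral>\<^sup>+z. ennreal \<bar>B k z - A k z\<bar> \<partial>M)"
      by (intro le assms)
    ultimately show ?case
      using sym elim by (auto elim!: order_trans intro!: add_left_mono)
  qed
qed

text \<open>The form used below. With \<open>r\<close> the identity it compares two policies; with
  \<open>r\<close> a quantizer and quantized \<open>\<alpha>\<close> it compares a finite cost with
  a true one.\<close>

lemma eventually_integral_ctilde_close: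
  assumes "N \<ge> 1" "m \<ge> 0" "\<And>i. i \<in> {1..<N} \<Longrightarrow> w i \<ge> 0" "\<delta> > 0"
    and r: "\<And>k. r k \<in> borel_measurable borel" "\<And>k t. \<bar>r k t\<bar> \<le> \<bar>t\<bar> + 1"
      "\<And>t. (\<lambda>k. r k t) \<longlonglongrightarrow> t"
    and \<alpha>: "\<And>k i. i \<in> {1..N} \<Longrightarrow> \<alpha> k i \<in> borel_measurable borel"
      "\<And>k i t. i \<in> {1..N} \<Longrightarrow> \<bar>\<alpha> k i t\<bar> \<le> m"
    and \<beta>: "\<And>k i. i \<in> {1..N} \<Longrightarrow> \<beta> k i \<in> borel_measurable borel"
      "\<And>k i t. i \<in> {1..N} \<Longrightarrow> \<bar>\<beta> k i t\<bar> \<le> m"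
    and \<alpha>\<beta>: "\<And>i. i \<in> {1..N} \<Longrightarrow> AE t in std_gaussian. (\<lambda>k. \<alpha> k i t - \<beta> k i t) \<longlonglongrightarrow> 0"
  shows "\<forall>\<^sub>F k in sequentially.
    (\<integral>\<^sup>+z. ennreal (relay_ctilde N w (z 0) (\<lambda>i. r k (z i)) (\<lambda>i. \<alpha> k i (z i))) \<partial>noise_law N)
      \<le> canonical_J N w (\<beta> k) + ennreal \<delta> \<and>
    canonical_J N w (\<beta> k) \<le>
      (\<integral>\<^sup>+z. ennreal (relay_ctilde N w (z 0) (\<lambda>i. r k (z i)) (\<lambda>i. \<alpha> k i (z i))) \<partial>noise_law N)
        + ennreal \<delta>"
proof -
  have "canonical_J N w (\<beta> k) =
      (\<integral>\<^sup>+z. ennreal (relay_ctilde N w (z 0) z (\<lambda>i. \<beta> k i (z i))) \<partial>noise_law N)" for k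
    using assms(1,3) \<beta>(1) by (intro canonical_J_eq_integral_ctilde) auto
  moreover have "(\<lambda>z. relay_ctilde N w (z 0) (\<lambda>i. r k (z i)) (\<lambda>i. \<alpha> k i (z i)))
      \<in> borel_measurable (noise_law N)"
    "(\<lambda>z. relay_ctilde N w (z 0) z (\<lambda>i. \<beta> k i (z i))) \<in> borel_measurable (noise_law N)" for k
    using assms(1) r(1) \<alpha>(1) \<beta>(1)
    by (intro borel_measurable_relay_ctilde borel_measurable_component
      borel_measurable_policy_component; simp)+
  ultimately show ?thesis
    using assms(3,4)
    by (simp only:) (intro eventually_nn_integral_le_add relay_ctilde_nonneg
      tendsto_integral_ctilde_diff[where m = m] assms r \<alpha> \<beta> \<alpha>\<beta>; simp)
qed

section \<open>Near optimal policies that are bounded and continuous\<close>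

lemma AE_std_gaussian_limit_of_bounded_continuous:
  assumes "g \<in> borel_measurable borel" "\<And>t. \<bar>g t\<bar> \<le> m"
  obtains c where "\<And>k :: nat. continuous_on UNIV (c k :: real \<Rightarrow> real)" "\<And>k t. \<bar>c k t\<bar> \<le> m"
    "AE t in std_gaussian. (\<lambda>k. c k t) \<longlonglongrightarrow> g t"
proof -
  \<comment> \<open>This notion of measurability already provides continuous functions converging to
    \<open>g\<close> off a negligible set; clipping them afterwards restores the bound.\<close>
  have "g measurable_on UNIV"
    using assms(1) by (intro lebesgue_measurable_imp_measurable_on) (auto intro: measurable_completion)
  then obtain Z c where Z: "negligible Z" and c: "\<And>k. continuous_on UNIV (c k)"
    and lim: "\<And>t. t \<notin> Z \<Longrightarrow> (\<lambda>k :: nat. c k t) \<longlonglongrightarrow> g t"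
    unfolding measurable_on_def by auto
  have "AE t in lborel. t \<notin> Z"
    using AE_not_in[of Z lebesgue] Z by (simp add: negligible_iff_null_sets AE_completion_iff)
  then have AE: "AE t in std_gaussian. t \<notin> Z"
    unfolding std_gaussian_def by (subst AE_density) auto
  have m: "0 \<le> m" using assms(2)[of 0] by linarith
  show ?thesis
  proof
    show "continuous_on UNIV (\<lambda>t. max (- m) (min m (c k t)))" for k
      by (intro continuous_intros c)
    show "\<bar>max (- m) (min m (c k t))\<bar> \<le> m" for k t using m by linarith
    show "AE t in std_gaussian. (\<lambda>k. max (- m) (min m (c k t))) \<longlonglongrightarrow> g t"
      using AE
    proof eventually_elim
      case (elim t)
      have "(\<lambda>k. max (- m) (min m (c k t))) \<longlonglongrightarrow> max (- m) (min m (g t))"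
        by (intro tendsto_intros lim elim)
      moreover have "max (- m) (min m (g t)) = g t" using assms(2)[of t] by linarith
      ultimately show ?case by simp
    qed
  qed
qed

section \<open>Clipping a policy of finite cost\<close>

lemma nn_integral_square_component_finite:
  "(\<integral>\<^sup>+\<xi>. ennreal ((\<xi> 0)\<^sup>2) \<partial>noise_law N) < \<infinity>"
proof -
  have "(\<xi> 0)\<^sup>2 \<le> 8 / 3 * (\<Prod>i\<le>N. exp (3 / 8 * (\<xi> i)\<^sup>2))" for \<xi> :: "nat \<Rightarrow> real"
  proof -
    have "3 / 8 * (\<xi> 0)\<^sup>2 \<le> exp (3 / 8 * (\<xi> 0)\<^sup>2)"
      using exp_ge_add_one_self[of "3 / 8 * (\<xi> 0)\<^sup>2"] by linarith
    also have "\<dots> \<le> exp (\<Sum>i\<le>N. 3 / 8 * (\<xi> i)\<^sup>2)"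
      using member_le_sum[of 0 "{..N}" "\<lambda>i. 3 / 8 * (\<xi> i)\<^sup>2"] by simp
    finally show ?thesis by (simp add: exp_sum)
  qed
  then have "(\<integral>\<^sup>+\<xi>. ennreal ((\<xi> 0)\<^sup>2) \<partial>noise_law N) \<le>
      (\<integral>\<^sup>+\<xi>. ennreal (8 / 3 * (\<Prod>i\<le>N. exp (3 / 8 * (\<xi> i)\<^sup>2))) \<partial>noise_law N)"
    by (intro nn_integral_mono ennreal_leI)
  also have "\<dots> < \<infinity>" by (rule nn_integral_prod_exp_square_finite) simp
  finally show ?thesis .
qed

text \<open>This is where positive weights matter: each power term controls its own action, while
  the last action is controlled by the error \<open>u N - x\<close> together with
  \<open>x\<close>.\<close>

lemma sum_square_le_relay_cost:
  assumes "N \<ge> 1" "\<And>i. i \<in> {1..<N} \<Longrightarrow> w i > 0"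
  shows "(\<Sum>i\<in>{1..N}. (u i)\<^sup>2) \<le> (2 + (\<Sum>i\<in>{1..<N}. 1 / w i)) * relay_cost N w x u + 2 * x\<^sup>2"
proof -
  let ?c = "relay_cost N w x u"
  have nonneg: "0 \<le> w i * (u i)\<^sup>2" if "i \<in> {1..<N}" for i
    using assms(2)[OF that] by simp
  have "(u i)\<^sup>2 \<le> 1 / w i * ?c" if i: "i \<in> {1..<N}" for i
  proof -
    have "w i * (u i)\<^sup>2 \<le> (\<Sum>i\<in>{1..<N}. w i * (u i)\<^sup>2)"
      using i nonneg by (intro member_le_sum) auto
    then have "w i * (u i)\<^sup>2 \<le> ?c" unfolding relay_cost_def using zero_le_power2[of "u N - x"] by linarith
    then show ?thesis using assms(2)[OF i] by (simp add: field_simps)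
  qed
  then have "(\<Sum>i\<in>{1..<N}. (u i)\<^sup>2) \<le> (\<Sum>i\<in>{1..<N}. 1 / w i) * ?c"
    unfolding sum_distrib_right by (rule sum_mono)
  moreover have "(u N)\<^sup>2 \<le> 2 * ?c + 2 * x\<^sup>2"
  proof -
    have "0 \<le> (u N - 2 * x)\<^sup>2" by simp
    then have "(u N)\<^sup>2 \<le> 2 * (u N - x)\<^sup>2 + 2 * x\<^sup>2"
      by (simp add: power2_diff power_mult_distrib mult_ac)
    moreover have "(u N - x)\<^sup>2 \<le> ?c"
      unfolding relay_cost_def using sum_nonneg[of "{1..<N}", OF nonneg] by simp
    ultimately show ?thesis by linarith
  qed
  moreover have "(\<Sum>i\<in>{1..N}. (u i)\<^sup>2) = (\<Sum>i\<in>{1..<N}. (u i)\<^sup>2) + (u N)\<^sup>2"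
    using assms(1) by (simp add: sum.last_plus)
  ultimately show ?thesis by (simp add: distrib_right)
qed

lemma bounded_policy_near_optimal:
  assumes "N \<ge> 1" "\<And>i. i \<in> {1..<N} \<Longrightarrow> w i > 0"
    and \<gamma>: "\<And>i. i \<in> {1..N} \<Longrightarrow> \<gamma> i \<in> borel_measurable borel"
    and "canonical_J N w \<gamma> < \<infinity>" "\<delta> > 0"
  shows "\<exists>m>0. \<exists>\<gamma>'. (\<forall>i\<in>{1..N}. \<gamma>' i \<in> borel_measurable borel \<and> (\<forall>t. \<bar>\<gamma>' i t\<bar> \<le> m)) \<and>
    canonical_J N w \<gamma>' \<le> canonical_J N w \<gamma> + ennreal \<delta>"
proof -
  define act where "act \<gamma> \<xi> = relay_action \<gamma> (\<xi> 0) (\<lambda>i. \<xi> (Suc i))" for \<gamma> \<xi>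
  define cost where "cost \<gamma> \<xi> = relay_cost N w (\<xi> 0) (act \<gamma> \<xi>)" for \<gamma> \<xi>
  define S where "S \<xi> = (\<Sum>i\<in>{1..N}. (act \<gamma> \<xi> i)\<^sup>2)" for \<xi>
  \<comment> \<open>\<open>W\<close> is the factor in \<open>relay_cost_le\<close>, \<open>V\<close>
    the one in \<open>sum_square_le_relay_cost\<close>. \<open>R\<close> bounds the clipped cost
    where clipping may act, and \<open>e k\<close> is the possible excess, zero where all actions
    fit below the level \<open>k + 1\<close>.\<close>
  define W where "W = 2 + sum w {1..<N}"
  define V where "V = 2 + (\<Sum>i\<in>{1..<N}. 1 / w i)"
  define R where "R \<xi> = 2 * (\<xi> 0)\<^sup>2 + W * S \<xi>" for \<xi>
  define trunc where "trunc k i t = max (- (real k + 1)) (min (real k + 1) (\<gamma> i t))" for k :: nat and i t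
  define e where "e k \<xi> = (if S \<xi> \<le> (real k + 1)\<^sup>2 then 0 else R \<xi>)" for k :: nat and \<xi>
  have w0: "w i \<ge> 0" if "i \<in> {1..<N}" for i using assms(2)[OF that] by simp
  have W: "W \<ge> 0" unfolding W_def by (intro add_nonneg_nonneg sum_nonneg) (use w0 in auto)
  have V: "V \<ge> 0" unfolding V_def by (intro add_nonneg_nonneg sum_nonneg) (use w0 in auto)
  have S0: "S \<xi> \<ge> 0" for \<xi> unfolding S_def by (intro sum_nonneg) auto
  have R0: "R \<xi> \<ge> 0" for \<xi> unfolding R_def using W S0[of \<xi>] by auto
  have J: "canonical_J N w \<gamma> = (\<integral>\<^sup>+\<xi>. ennreal (cost \<gamma> \<xi>) \<partial>noise_law N)" for \<gamma>
    unfolding relay_J_def cost_def act_def ..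
  have cost0: "cost \<gamma> \<xi> \<ge> 0" for \<gamma> \<xi> unfolding cost_def by (intro relay_cost_nonneg w0)
  have trunc_measurable: "trunc k i \<in> borel_measurable borel" if "i \<in> {1..N}" for k i
    unfolding trunc_def using \<gamma>[OF that] by measurable
  have trunc_le: "\<bar>trunc k i t\<bar> \<le> real k + 1" for k i t unfolding trunc_def by linarith
  have cost_measurable [measurable]: "cost \<gamma> \<in> borel_measurable (noise_law N)"
    unfolding cost_def act_def by (intro borel_measurable_canonical_cost assms \<gamma>)
  have [measurable]: "(\<lambda>\<xi>. \<xi> 0) \<in> borel_measurable (noise_law N)"
    by (intro borel_measurable_component) auto
  have [measurable]: "S \<in> borel_measurable (noise_law N)"
    unfolding S_def act_def
    by (intro borel_measurable_sum borel_measurable_power borel_measurable_relay_action) (auto intro: \<gamma>)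
  have R_measurable [measurable]: "R \<in> borel_measurable (noise_law N)" unfolding R_def by measurable
  have e_measurable [measurable]: "e k \<in> borel_measurable (noise_law N)" for k unfolding e_def by measurable
  have cost_le: "cost (trunc k) \<xi> \<le> cost \<gamma> \<xi> + e k \<xi>" for k \<xi>
  proof (cases "S \<xi> \<le> (real k + 1)\<^sup>2")
    case True
    have "\<bar>act \<gamma> \<xi> i\<bar> \<le> real k + 1" if "i \<in> {1..N}" for i
    proof -
      have "(act \<gamma> \<xi> i)\<^sup>2 \<le> S \<xi>" unfolding S_def using that by (intro member_le_sum) auto
      then have "(act \<gamma> \<xi> i)\<^sup>2 \<le> (real k + 1)\<^sup>2" using True by simp
      then show ?thesis using abs_le_square_iff[of "act \<gamma> \<xi> i" "real k + 1"] by simp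
    qed
    \<comment> \<open>If no original action exceeds the level, clipping never acts, and inductively
      every agent sees the same observation.\<close>
    then have "act (trunc k) \<xi> i = act \<gamma> \<xi> i" if "i \<le> N" for i
      using that
    proof (induction i)
      case (Suc i)
      then show ?case using Suc.prems(1)[of "Suc i"] by (auto simp: act_def trunc_def)
    qed (simp add: act_def)
    then have "cost (trunc k) \<xi> = cost \<gamma> \<xi>"
      unfolding cost_def using assms(1) by (intro relay_cost_cong) auto
    then show ?thesis using True by (simp add: e_def)
  next
    case False
    have "\<bar>act (trunc k) \<xi> i\<bar> \<le> real k + 1" if "i \<in> {1..N}" for i
      using that trunc_le by (cases i) (auto simp: act_def)
    then have "cost (trunc k) \<xi> \<le> 2 * (\<xi> 0)\<^sup>2 + W * (real k + 1)\<^sup>2"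
      unfolding cost_def W_def by (intro relay_cost_le assms(1) w0) auto
    \<comment> \<open>Here \<open>S\<close> exceeds the squared level, so a bound growing with
      \<open>k\<close> is replaced by one independent of \<open>k\<close>.\<close>
    also have "\<dots> \<le> R \<xi>" unfolding R_def using False W by (intro add_left_mono mult_left_mono) auto
    finally show ?thesis using False cost0[of \<gamma> \<xi>] by (simp add: e_def)
  qed
  have R_le: "R \<xi> \<le> (2 + 2 * W) * (\<xi> 0)\<^sup>2 + (W * V) * cost \<gamma> \<xi>" for \<xi>
  proof -
    have "S \<xi> \<le> V * cost \<gamma> \<xi> + 2 * (\<xi> 0)\<^sup>2"
      unfolding S_def cost_def V_def by (rule sum_square_le_relay_cost[OF assms(1,2)])
    then have "W * S \<xi> \<le> W * (V * cost \<gamma> \<xi> + 2 * (\<xi> 0)\<^sup>2)" using W by (rule mult_left_mono)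
    then show ?thesis unfolding R_def by (simp add: algebra_simps)
  qed
  have "(\<integral>\<^sup>+\<xi>. ennreal (R \<xi>) \<partial>noise_law N) \<le>
      (\<integral>\<^sup>+\<xi>. ennreal (2 + 2 * W) * ennreal ((\<xi> 0)\<^sup>2) + ennreal (W * V) * ennreal (cost \<gamma> \<xi>) \<partial>noise_law N)"
    using R_le W V cost0
    by (intro nn_integral_mono) (simp flip: ennreal_mult ennreal_plus add: ennreal_leI)
  also have "\<dots> = ennreal (2 + 2 * W) * (\<integral>\<^sup>+\<xi>. ennreal ((\<xi> 0)\<^sup>2) \<partial>noise_law N) +
      ennreal (W * V) * (\<integral>\<^sup>+\<xi>. ennreal (cost \<gamma> \<xi>) \<partial>noise_law N)"
    by (simp add: nn_integral_add nn_integral_cmult)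
  also have "\<dots> < \<infinity>"
    using nn_integral_square_component_finite[of N] assms(4) unfolding J
    by (simp add: ennreal_mult_less_top)
  finally have R_finite: "(\<integral>\<^sup>+\<xi>. ennreal (R \<xi>) \<partial>noise_law N) < \<infinity>" .
  have "(\<lambda>k. \<integral>\<^sup>+\<xi>. ennreal (e k \<xi>) \<partial>noise_law N) \<longlonglongrightarrow> (\<integral>\<^sup>+\<xi>. 0 \<partial>noise_law N)"
  proof (rule nn_integral_dominated_convergence[where w = "\<lambda>\<xi>. ennreal (R \<xi>)", OF _ _ _ _ R_finite])
    show "AE \<xi> in noise_law N. ennreal (e k \<xi>) \<le> ennreal (R \<xi>)" for k
      using R0 by (intro AE_I2 ennreal_leI) (simp add: e_def)
    show "AE \<xi> in noise_law N. (\<lambda>k. ennreal (e k \<xi>)) \<longlonglongrightarrow> 0"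
    proof (rule AE_I2, rule tendsto_eventually)
      fix \<xi>
      obtain n where n: "S \<xi> \<le> real n" using real_arch_simple by blast
      have "S \<xi> \<le> (real k + 1)\<^sup>2" if "n \<le> k" for k
      proof -
        have "real n \<le> real k + 1" using that by simp
        also have "\<dots> \<le> (real k + 1)\<^sup>2" by (simp add: power2_eq_square)
        finally show ?thesis using n by linarith
      qed
      then show "\<forall>\<^sub>F k in sequentially. ennreal (e k \<xi>) = 0"
        unfolding e_def by (auto simp: eventually_sequentially)
    qed
  qed measurable
  then have "\<forall>\<^sub>F k in sequentially. (\<integral>\<^sup>+\<xi>. ennreal (e k \<xi>) \<partial>noise_law N) < ennreal \<delta>"
    using assms(5) by (intro order_tendstoD(2)) auto
  then obtain k where k: "(\<integral>\<^sup>+\<xi>. ennreal (e k \<xi>) \<partial>noise_law N) < ennreal \<delta>"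
    using eventually_happens by fastforce
  have e0: "0 \<le> e k \<xi>" for \<xi> unfolding e_def using R0 by simp
  have "canonical_J N w (trunc k) \<le> (\<integral>\<^sup>+\<xi>. ennreal (cost \<gamma> \<xi>) + ennreal (e k \<xi>) \<partial>noise_law N)"
    unfolding J using cost_le cost0 e0
    by (intro nn_integral_mono) (simp flip: ennreal_plus add: ennreal_leI)
  also have "\<dots> = canonical_J N w \<gamma> + (\<integral>\<^sup>+\<xi>. ennreal (e k \<xi>) \<partial>noise_law N)"
    unfolding J by (intro nn_integral_add) auto
  also have "\<dots> \<le> canonical_J N w \<gamma> + ennreal \<delta>" using k by (intro add_left_mono) simp
  finally have "canonical_J N w (trunc k) \<le> canonical_J N w \<gamma> + ennreal \<delta>" .
  then show ?thesis
    using trunc_measurable trunc_le by (intro exI[of _ "real k + 1"] conjI exI[of _ "trunc k"]) auto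
qed

text \<open>Continuity is needed later, because quantizing the argument of a policy is harmless in
  the limit only at continuity points.\<close>

lemma continuous_policy_near_optimal:
  assumes "N \<ge> 1" "m \<ge> 0" "\<And>i. i \<in> {1..<N} \<Longrightarrow> w i \<ge> 0" "\<delta> > 0"
    and \<gamma>: "\<And>i. i \<in> {1..N} \<Longrightarrow> \<gamma> i \<in> borel_measurable borel"
      "\<And>i t. i \<in> {1..N} \<Longrightarrow> \<bar>\<gamma> i t\<bar> \<le> m"
  shows "\<exists>\<gamma>'. (\<forall>i\<in>{1..N}. continuous_on UNIV (\<gamma>' i) \<and> (\<forall>t. \<bar>\<gamma>' i t\<bar> \<le> m)) \<and>
    canonical_J N w \<gamma>' \<le> canonical_J N w \<gamma> + ennreal \<delta>"
proof -
  have "\<exists>c. (\<forall>k :: nat. continuous_on UNIV (c k)) \<and> (\<forall>k t. \<bar>c k t\<bar> \<le> m) \<and>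
      (AE t in std_gaussian. (\<lambda>k. c k t) \<longlonglongrightarrow> \<gamma> i t)" if "i \<in> {1..N}" for i
    by (rule AE_std_gaussian_limit_of_bounded_continuous[OF \<gamma>[OF that]]) blast
  then obtain c where c: "\<And>i k. i \<in> {1..N} \<Longrightarrow> continuous_on UNIV (c i (k :: nat))"
      "\<And>i k t. i \<in> {1..N} \<Longrightarrow> \<bar>c i k t\<bar> \<le> m"
      "\<And>i. i \<in> {1..N} \<Longrightarrow> AE t in std_gaussian. (\<lambda>k. c i k t) \<longlonglongrightarrow> \<gamma> i t"
    by metis
  have meas: "c i k \<in> borel_measurable borel" if "i \<in> {1..N}" for i k
    by (rule borel_measurable_continuous_onI[OF c(1)[OF that]])
  have lim: "AE t in std_gaussian. (\<lambda>k. c i k t - \<gamma> i t) \<longlonglongrightarrow> 0" if "i \<in> {1..N}" for i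
    using c(3)[OF that] by eventually_elim (rule LIM_zero)
  have "\<forall>\<^sub>F k in sequentially.
      (\<integral>\<^sup>+z. ennreal (relay_ctilde N w (z 0) z (\<lambda>i. c i k (z i))) \<partial>noise_law N)
        \<le> canonical_J N w \<gamma> + ennreal \<delta>"
    \<comment> \<open>The observations are unperturbed here; only the actions change, against the
      constant sequence \<open>\<gamma>\<close>.\<close>
    by (rule eventually_mono[OF eventually_integral_ctilde_close
        [where N = N and m = m and w = w and \<delta> = \<delta> and r = "\<lambda>_ t. t" and \<alpha> = "\<lambda>k i. c i k" and \<beta> = "\<lambda>_. \<gamma>"]])
      (use assms c(2) meas lim in auto)
  then obtain k where "(\<integral>\<^sup>+z. ennreal (relay_ctilde N w (z 0) z (\<lambda>i. c i k (z i))) \<partial>noise_law N)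
      \<le> canonical_J N w \<gamma> + ennreal \<delta>"
    using eventually_happens by fastforce
  then have "canonical_J N w (\<lambda>i. c i k) \<le> canonical_J N w \<gamma> + ennreal \<delta>"
    by (subst canonical_J_eq_integral_ctilde) (use assms meas in auto)
  then show ?thesis using c(1,2) by (intro exI[of _ "\<lambda>i. c i k"]) blast
qed

section \<open>Optimal policies of the finite models\<close>

text \<open>With \<open>l = k + 1\<close> and \<open>n = (k + 1)^2\<close> the range grows to the
  whole line while the half cell \<open>l / n = 1 / (k + 1)\<close> shrinks.\<close>

lemma quantizer_tendsto:
  "(\<lambda>k. quantizer (real (Suc k)) ((Suc k)\<^sup>2) t) \<longlonglongrightarrow> t"
proof (rule LIM_zero_cancel, rule Lim_null_comparison)
  obtain n where n: "\<bar>t\<bar> \<le> real n" using real_arch_simple by blast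
  have "\<bar>quantizer (real (Suc k)) ((Suc k)\<^sup>2) t - t\<bar> \<le> inverse (real (Suc k))" if "n \<le> k" for k
  proof -
    have div_square: "c / c\<^sup>2 = inverse c" if "c > 0" for c :: real
      using that by (simp add: power2_eq_square inverse_eq_divide)
    have "real (Suc k) / real ((Suc k)\<^sup>2) = inverse (real (Suc k))"
      unfolding of_nat_power by (rule div_square) simp
    moreover have "\<bar>quantizer (real (Suc k)) ((Suc k)\<^sup>2) t - t\<bar> \<le> real (Suc k) / real ((Suc k)\<^sup>2)"
      using n that by (intro abs_quantizer_diff_le) auto
    ultimately show ?thesis by (simp only:)
  qed
  then show "\<forall>\<^sub>F k in sequentially.
      norm (quantizer (real (Suc k)) ((Suc k)\<^sup>2) t - t) \<le> inverse (real (Suc k))"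
    by (auto simp: eventually_sequentially)
qed (rule LIMSEQ_inverse_real_of_nat)

theorem theorem10:
  fixes P :: "'a measure" and x :: "'a \<Rightarrow> real" and v :: "nat \<Rightarrow> 'a \<Rightarrow> real"
    and N :: nat and w :: "nat \<Rightarrow> real" and \<epsilon> :: real
  assumes "prob_space P"
    and "N \<ge> 1"
    and "distributed P lborel x (\<lambda>t. ennreal (std_normal_density t))"
    and "\<And>i. i < N \<Longrightarrow> distributed P lborel (v i) (\<lambda>t. ennreal (std_normal_density t))"
    and "prob_space.indep_vars P (\<lambda>_. borel) (case_nat x v) {..N}"
    and "\<And>i. i \<in> {1..<N} \<Longrightarrow> w i > 0"
    and "\<epsilon> > 0"
  shows "\<exists>(l::real) (n::nat) (m::real). l > 0 \<and> n \<ge> 1 \<and> m > 0 \<and>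
    (\<forall>\<pi>. is_arg_min (relay_J_fin l n N w) (\<lambda>\<pi>. \<pi> \<in> fin_policies l n N {-m..m}) \<pi> \<longrightarrow>
      relay_J P x v N w (\<lambda>i. \<pi> i \<circ> quantizer l n) \<le> relay_J_opt P x v N w + ennreal \<epsilon>)"
proof (cases "relay_J_opt P x v N w = \<infinity>")
  case True
  \<comment> \<open>An infinite optimum bounds every cost, so any parameters serve.\<close>
  then show ?thesis by (intro exI[of _ 1]) auto
next
  case False
  let ?opt = "relay_J_opt P x v N w"
  \<comment> \<open>Five losses are incurred: choosing a near optimal policy, clipping it, making it
    continuous, passing to its finite cost, and passing from the finite cost of the minimizer back
    to its true cost.\<close>
  define \<delta> where "\<delta> = \<epsilon> / 5"
  have \<delta>: "\<delta> > 0" using assms(7) by (simp add: \<delta>_def)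
  have w0: "w i \<ge> 0" if "i \<in> {1..<N}" for i using assms(6)[OF that] by simp
  note relay_J_eq = relay_J_eq_canonical_J[OF assms(1-5)]
  have "?opt < ?opt + ennreal \<delta>"
    using False \<delta> ennreal_add_left_cancel_less[of ?opt 0 "ennreal \<delta>"] by simp
  then have "(INF \<gamma>\<in>{\<gamma>. \<forall>i\<in>{1..N}. \<gamma> i \<in> borel_measurable borel}. relay_J P x v N w \<gamma>)
      < ?opt + ennreal \<delta>"
    by (simp only: relay_J_opt_def)
  then obtain \<gamma>\<^sub>0 where \<gamma>\<^sub>0: "\<And>i. i \<in> {1..N} \<Longrightarrow> \<gamma>\<^sub>0 i \<in> borel_measurable borel"
      and "relay_J P x v N w \<gamma>\<^sub>0 < ?opt + ennreal \<delta>"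
    unfolding INF_less_iff by blast
  then have J\<^sub>0: "canonical_J N w \<gamma>\<^sub>0 < ?opt + ennreal \<delta>" using relay_J_eq[of \<gamma>\<^sub>0] by simp
  also have "\<dots> < \<infinity>" using False by (simp add: less_top)
  finally have "canonical_J N w \<gamma>\<^sub>0 < \<infinity>" .
  \<comment> \<open>The action bound \<open>m\<close> is fixed here, before any grid is
    chosen.\<close>
  then obtain \<gamma>\<^sub>1 m where m: "m > 0" and \<gamma>\<^sub>1: "\<And>i. i \<in> {1..N} \<Longrightarrow> \<gamma>\<^sub>1 i \<in> borel_measurable borel"
      "\<And>i t. i \<in> {1..N} \<Longrightarrow> \<bar>\<gamma>\<^sub>1 i t\<bar> \<le> m"
      and J\<^sub>1: "canonical_J N w \<gamma>\<^sub>1 \<le> canonical_J N w \<gamma>\<^sub>0 + ennreal \<delta>"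
    using bounded_policy_near_optimal[where w = w and \<gamma> = \<gamma>\<^sub>0, OF assms(2,6) \<gamma>\<^sub>0 _ \<delta>] by blast
  obtain \<gamma> where \<gamma>: "\<And>i. i \<in> {1..N} \<Longrightarrow> continuous_on UNIV (\<gamma> i)"
      "\<And>i t. i \<in> {1..N} \<Longrightarrow> \<bar>\<gamma> i t\<bar> \<le> m"
      and J: "canonical_J N w \<gamma> \<le> canonical_J N w \<gamma>\<^sub>1 + ennreal \<delta>"
    using continuous_policy_near_optimal[where w = w and \<gamma> = \<gamma>\<^sub>1, OF assms(2) less_imp_le[OF m] w0 \<delta> \<gamma>\<^sub>1] by blast
  have \<gamma>_measurable: "\<gamma> i \<in> borel_measurable borel" if "i \<in> {1..N}" for i
    by (rule borel_measurable_continuous_onI[OF \<gamma>(1)[OF that]])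
  define l where "l k = real (Suc k)" for k
  define n where "n k = (Suc k)\<^sup>2" for k
  have l: "l k > 0" and n: "n k \<ge> 1" for k by (auto simp: l_def n_def)
  have ln: "l k / real (n k) \<le> 1" for k
  proof -
    have "l k \<le> real (n k)" unfolding l_def n_def by (intro of_nat_mono self_le_power) auto
    then show ?thesis using n[of k] by simp
  qed
  have q: "quantizer (l k) (n k) \<in> borel_measurable borel"
    "\<bar>quantizer (l k) (n k) t\<bar> \<le> \<bar>t\<bar> + 1" "(\<lambda>k. quantizer (l k) (n k) t) \<longlonglongrightarrow> t" for k t
    using borel_measurable_quantizer[OF l n] quantizer_tendsto[of t]
      order_trans[OF abs_quantizer_le[OF l[of k] n[of k], of t] add_left_mono[OF ln[of k]]]
    by (auto simp: l_def n_def)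
  have J_fin: "relay_J_fin (l k) (n k) N w \<pi> =
      (\<integral>\<^sup>+z. ennreal (relay_ctilde N w (z 0) (\<lambda>i. quantizer (l k) (n k) (z i))
        (\<lambda>i. \<pi> i (quantizer (l k) (n k) (z i)))) \<partial>noise_law N)" for k \<pi>
    using l n assms(2) w0 by (rule relay_J_fin_eq)
  note close = eventually_integral_ctilde_close[where w = w and r = "\<lambda>k. quantizer (l k) (n k)",
      OF assms(2) less_imp_le[OF m] w0 \<delta> q]
  show ?thesis
  proof (rule ccontr)
    assume contra: "\<not> ?thesis"
    \<comment> \<open>If no parameters work, then for this \<open>m\<close> every grid of the
      sequence has a bad minimizer. The asymptotic estimates are applied to such a sequence of
      minimizers.\<close>
    have "\<exists>\<pi>. is_arg_min (relay_J_fin (l k) (n k) N w) (\<lambda>\<pi>. \<pi> \<in> fin_policies (l k) (n k) N {-m..m}) \<pi> \<and>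
        \<not> relay_J P x v N w (\<lambda>i. \<pi> i \<circ> quantizer (l k) (n k)) \<le> ?opt + ennreal \<epsilon>" for k
      using contra l[of k] n[of k] m by blast
    then obtain \<pi> where \<pi>: "\<And>k. is_arg_min (relay_J_fin (l k) (n k) N w)
          (\<lambda>\<pi>. \<pi> \<in> fin_policies (l k) (n k) N {-m..m}) (\<pi> k)"
        and bad: "\<And>k. \<not> relay_J P x v N w (\<lambda>i. \<pi> k i \<circ> quantizer (l k) (n k)) \<le> ?opt + ennreal \<epsilon>"
      by metis
    have quantized_measurable: "\<pi> k i \<circ> quantizer (l k) (n k) \<in> borel_measurable borel"
      for \<pi> :: "nat \<Rightarrow> nat \<Rightarrow> real \<Rightarrow> real" and k i
      by (rule borel_measurable_quantized_policy[OF l n])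
    have \<pi>_bound: "\<bar>(\<pi> k i \<circ> quantizer (l k) (n k)) t\<bar> \<le> m" if "i \<in> {1..N}" for k i t
    proof -
      have "\<pi> k \<in> fin_policies (l k) (n k) N {-m..m}" using \<pi>[of k] by (simp add: is_arg_min_def)
      then have "\<pi> k i (quantizer (l k) (n k) t) \<in> {-m..m}"
        using that quantizer_in_grid[OF l[of k] n[of k], of t] unfolding fin_policies_def by (auto simp: PiE_iff)
      then show ?thesis by auto
    qed
    have "\<forall>\<^sub>F k in sequentially. canonical_J N w (\<lambda>i. \<pi> k i \<circ> quantizer (l k) (n k))
        \<le> relay_J_fin (l k) (n k) N w (\<pi> k) + ennreal \<delta>"
      \<comment> \<open>Both policy sequences are the quantized minimizers, so no convergence of
        \<open>\<pi>\<close> is required; only the density sees different observations.\<close>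
      by (rule eventually_mono[OF close
          [of "\<lambda>k i. \<pi> k i \<circ> quantizer (l k) (n k)" "\<lambda>k i. \<pi> k i \<circ> quantizer (l k) (n k)"]])
        (use quantized_measurable[of \<pi>] \<pi>_bound in \<open>auto simp: J_fin comp_def\<close>)
    moreover have "\<forall>\<^sub>F k in sequentially. relay_J_fin (l k) (n k) N w \<gamma> \<le> canonical_J N w \<gamma> + ennreal \<delta>"
    proof -
      have lim: "(\<lambda>k. \<gamma> i (quantizer (l k) (n k) t) - \<gamma> i t) \<longlonglongrightarrow> 0" if "i \<in> {1..N}" for i t
        using \<gamma>(1)[OF that] q(3)[of t]
        by (intro LIM_zero isCont_tendsto_compose[where g = "\<gamma> i"]) (auto simp: continuous_on_eq_continuous_at)
      show ?thesis
        by (rule eventually_mono[OF close[of "\<lambda>k i. \<gamma> i \<circ> quantizer (l k) (n k)" "\<lambda>k. \<gamma>"]])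
          (use quantized_measurable[of "\<lambda>_. \<gamma>"] \<gamma>(2) \<gamma>_measurable lim in \<open>auto simp: J_fin comp_def\<close>)
    qed
    ultimately have "\<forall>\<^sub>F k in sequentially.
        canonical_J N w (\<lambda>i. \<pi> k i \<circ> quantizer (l k) (n k)) \<le> relay_J_fin (l k) (n k) N w (\<pi> k) + ennreal \<delta> \<and>
        relay_J_fin (l k) (n k) N w \<gamma> \<le> canonical_J N w \<gamma> + ennreal \<delta>"
      by (rule eventually_conj)
    then obtain k where k:
        "canonical_J N w (\<lambda>i. \<pi> k i \<circ> quantizer (l k) (n k)) \<le> relay_J_fin (l k) (n k) N w (\<pi> k) + ennreal \<delta>"
        "relay_J_fin (l k) (n k) N w \<gamma> \<le> canonical_J N w \<gamma> + ennreal \<delta>"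
      using eventually_happens by fastforce
    \<comment> \<open>The continuous policy cut down to the grid, with the default value elsewhere
      that membership in \<open>fin_policies\<close> demands. It is a competitor of the minimizer,
      and its finite cost is that of \<open>\<gamma>\<close>, as only grid values are read.\<close>
    define \<rho> where "\<rho> = (\<lambda>i\<in>{1..N}. \<lambda>z\<in>quant_grid (l k) (n k). \<gamma> i z)"
    have "\<gamma> i t \<in> {-m..m}" if "i \<in> {1..N}" for i t using \<gamma>(2)[OF that, of t] by auto
    then have "\<rho> \<in> fin_policies (l k) (n k) N {-m..m}"
      unfolding fin_policies_def \<rho>_def restrict_PiE_iff by blast
    then have "relay_J_fin (l k) (n k) N w (\<pi> k) \<le> relay_J_fin (l k) (n k) N w \<rho>"
      using \<pi>[of k] by (auto simp: is_arg_min_def not_less)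
    also have "relay_J_fin (l k) (n k) N w \<rho> = relay_J_fin (l k) (n k) N w \<gamma>"
      unfolding J_fin \<rho>_def
      by (intro nn_integral_cong arg_cong[where f = ennreal] relay_ctilde_cong assms(2))
        (auto simp: quantizer_in_grid[OF l n])
    finally have "relay_J_fin (l k) (n k) N w (\<pi> k) \<le> relay_J_fin (l k) (n k) N w \<gamma>" .
    then have "canonical_J N w (\<lambda>i. \<pi> k i \<circ> quantizer (l k) (n k)) \<le>
        ((((?opt + ennreal \<delta>) + ennreal \<delta>) + ennreal \<delta>) + ennreal \<delta>) + ennreal \<delta>"
      using k J J\<^sub>1 less_imp_le[OF J\<^sub>0] by (meson add_right_mono order_trans)
    also have "\<dots> = ?opt + ennreal \<epsilon>"
      using \<delta> by (simp add: \<delta>_def add.assoc flip: ennreal_plus)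
    finally show False
      using bad[of k] relay_J_eq[of "\<lambda>i. \<pi> k i \<circ> quantizer (l k) (n k)"]
        quantized_measurable[of \<pi> k] by simp
  qed
qed

end
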